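(* Over a field $\mathbb{K}$ of characteristic $0$, the Koszul dual operad $\mathrm{di}\text{-}\mathrm{Com}^{\mathrm I\,(!)}$ of the quadratic operad $\mathrm{di}\text{-}\mathrm{Com}^{\mathrm I}$ of initial commutative dialgebras is the Lie-admissible operad, i.e. the operad of algebras with one bilinear operation whose commutator $[u,v]=uv-vu$ satisfies the Jacobi identity.
   Context: The variety $\mathrm{di}\text{-}\mathrm{Com}^{\mathrm I}$ of initial commutative dialgebras consists of vector spaces with two bilinear operations $\vdash,\dashv$ with $a\vdash b=b\dashv a$, satisfying the associative dialgebra identities $$a\dashv(b\dashv c)=a\dashv(b\vdash c),\quad (a\vdash b)\vdash c=(a\dashv b)\vdash c,$$ $$(a\dashv b)\dashv c=a\dashv(b\dashv c),\quad (a\vdash b)\dashv c=a\vdash(b\dashv c),\quad (a\vdash b)\vdash c=a\vdash(b\vdash c),$$ and the additional identity $(a\vdash b)\vdash c=a\dashv(b\dashv c)$. In terms of the single operation $ab=a\dashv b$ this is the variety of two-sided perm algebras: associative algebras satisfying left- and right-commutativity, $abc=bac$ and $abc=acb$. The corresponding operad is the quadratic operad generated by one binary operation without symmetry with these relations. For a quadratic operad $\mathcal{P}$ generated by one binary operation without symmetry, the Koszul dual operad $\mathcal{P}^{(!)}$ is presented, again with one generating binary operation without symmetry, as follows: an algebra $U$ is a $\mathcal{P}^{(!)}$-algebra if and only if for every $\mathcal{P}$-algebra $S$ the space $S\otimes U$ with product $(a\otimes u)(b\otimes v)=ab\otimes uv$ is Lie-admissible, i.e. a Lie algebra under the commutator.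 *)

theory Defs
  imports
    "HOL-Algebra.Module"
    "HOL-Algebra.Algebraic_Closure_Type"
    "HOL-Combinatorics.Permutations"
    "HOL-Library.Poly_Mapping"
begin

section \<open>Free vector spaces\<close>

text \<open>The free \<open>'k\<close>-vector space on a type \<open>'a\<close> is \<open>'a \<Rightarrow>\<^sub>0 'k\<close>;
  the basis vector belonging to \<open>x\<close> is \<open>Poly_Mapping.single x 1\<close>.\<close>

definition fscale :: "'k::field \<Rightarrow> ('a \<Rightarrow>\<^sub>0 'k) \<Rightarrow> ('a \<Rightarrow>\<^sub>0 'k)" where
  "fscale c f = Poly_Mapping.map ((*) c) f"

lemma lookup_fscale [simp]: "Poly_Mapping.lookup (fscale c f) x = c * Poly_Mapping.lookup f x"
  by (simp add: fscale_def Poly_Mapping.map.rep_eq when_def)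

interpretation fvs: vector_space fscale
  by unfold_locales (auto intro!: poly_mapping_eqI simp: lookup_add algebra_simps)

definition lin_ext :: "('a \<Rightarrow> 'b) \<Rightarrow> ('a \<Rightarrow>\<^sub>0 'k::field) \<Rightarrow> ('b \<Rightarrow>\<^sub>0 'k)" where
  "lin_ext h f = (\<Sum>x\<in>Poly_Mapping.keys f. Poly_Mapping.single (h x) (Poly_Mapping.lookup f x))"

definition bilin_ext ::
    "('a \<Rightarrow> 'b \<Rightarrow> 'c) \<Rightarrow> ('a \<Rightarrow>\<^sub>0 'k::field) \<Rightarrow> ('b \<Rightarrow>\<^sub>0 'k) \<Rightarrow> ('c \<Rightarrow>\<^sub>0 'k)" where
  "bilin_ext h f g = (\<Sum>x\<in>Poly_Mapping.keys f. \<Sum>y\<in>Poly_Mapping.keys g.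
     Poly_Mapping.single (h x y) (Poly_Mapping.lookup f x * Poly_Mapping.lookup g y))"


section \<open>Operads generated by one binary operation without symmetry\<close>

datatype 'x mterm = Var 'x | App "'x mterm" "'x mterm"

primrec leaves :: "'x mterm \<Rightarrow> 'x list" where
  "leaves (Var x) = [x]"
| "leaves (App s t) = leaves s @ leaves t"

primrec mterm_subst :: "('x \<Rightarrow> 'y mterm) \<Rightarrow> 'x mterm \<Rightarrow> 'y mterm" where
  "mterm_subst \<sigma> (Var x) = \<sigma> x"
| "mterm_subst \<sigma> (App s t) = App (mterm_subst \<sigma> s) (mterm_subst \<sigma> t)"

text \<open>\<open>Mag n\<close> is the component of arity \<open>n\<close> of the free symmetric operad on one binary operation
  without symmetry: the space of multilinear nonassociative polynomials in the
  variables \<open>0, \<dots>, n - 1\<close>. The symmetric group acts by renaming variables.\<close>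

definition Mag :: "nat \<Rightarrow> (nat mterm \<Rightarrow>\<^sub>0 'k::field) set" where
  "Mag n = {f. \<forall>t\<in>Poly_Mapping.keys f. distinct (leaves t) \<and> set (leaves t) = {..<n}}"

text \<open>Partial composition: \<open>g\<close>, of arity \<open>n\<close>, is plugged into the input \<open>i\<close> of \<open>f\<close>; inputs are
  counted from \<open>0\<close>, and the inputs of \<open>f\<close> after \<open>i\<close> are shifted by \<open>n - 1\<close>.\<close>

definition mterm_comp :: "nat \<Rightarrow> nat \<Rightarrow> nat mterm \<Rightarrow> nat mterm \<Rightarrow> nat mterm" where
  "mterm_comp i n s t = mterm_subst
     (\<lambda>j. if j < i then Var j
          else if j = i then map_mterm (\<lambda>k. i + k) t
          else Var (j + n - 1)) s"

definition mag_comp ::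
    "nat \<Rightarrow> nat \<Rightarrow> (nat mterm \<Rightarrow>\<^sub>0 'k::field) \<Rightarrow> (nat mterm \<Rightarrow>\<^sub>0 'k) \<Rightarrow> (nat mterm \<Rightarrow>\<^sub>0 'k)" where
  "mag_comp i n f g = bilin_ext (mterm_comp i n) f g"

text \<open>An operad with one generating binary operation without symmetry is a quotient \<open>Mag / I\<close> by an
  operadic ideal \<open>I\<close>. Throughout it is represented by \<open>I\<close>, so that equality of two such operads
  means that they impose the same relations on their generating operations.\<close>

definition operadic_ideal :: "(nat \<Rightarrow> (nat mterm \<Rightarrow>\<^sub>0 'k::field) set) \<Rightarrow> bool" where
  "operadic_ideal I \<longleftrightarrow>
     (\<forall>n. I n \<subseteq> Mag n \<and> fvs.subspace (I n)) \<and>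
     (\<forall>n f \<pi>. f \<in> I n \<longrightarrow> \<pi> permutes {..<n} \<longrightarrow> lin_ext (map_mterm \<pi>) f \<in> I n) \<and>
     (\<forall>m n i f g. i < m \<longrightarrow> f \<in> Mag m \<longrightarrow> g \<in> Mag n \<longrightarrow> f \<in> I m \<or> g \<in> I n \<longrightarrow>
        mag_comp i n f g \<in> I (m + n - 1))"

definition quadratic_operad ::
    "(nat mterm \<Rightarrow>\<^sub>0 'k::field) set \<Rightarrow> nat \<Rightarrow> (nat mterm \<Rightarrow>\<^sub>0 'k) set" where
  "quadratic_operad R n = \<Inter> {I n | I. operadic_ideal I \<and> R \<subseteq> I 3}"


section \<open>Algebras with one bilinear operation\<close>

text \<open>The field \<open>one\<close> of the record type \<open>module\<close> plays no role below.\<close>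

locale nonassoc_algebra = Module.module ring_of_type_algebra A
  for A :: "('k::field, 'v) module" (structure) +
  assumes mult_closed: "\<lbrakk>x \<in> carrier A; y \<in> carrier A\<rbrakk> \<Longrightarrow> x \<otimes> y \<in> carrier A"
    and mult_add_left:
      "\<lbrakk>x \<in> carrier A; y \<in> carrier A; z \<in> carrier A\<rbrakk> \<Longrightarrow> (x \<oplus> y) \<otimes> z = (x \<otimes> z) \<oplus> (y \<otimes> z)"
    and mult_add_right:
      "\<lbrakk>x \<in> carrier A; y \<in> carrier A; z \<in> carrier A\<rbrakk> \<Longrightarrow> x \<otimes> (y \<oplus> z) = (x \<otimes> y) \<oplus> (x \<otimes> z)"
    and mult_smult_left:
      "\<lbrakk>x \<in> carrier A; y \<in> carrier A\<rbrakk> \<Longrightarrow> (c \<odot> x) \<otimes> y = c \<odot> (x \<otimes> y)"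
    and mult_smult_right:
      "\<lbrakk>x \<in> carrier A; y \<in> carrier A\<rbrakk> \<Longrightarrow> x \<otimes> (c \<odot> y) = c \<odot> (x \<otimes> y)"

locale lie_algebra = nonassoc_algebra A for A :: "('k::field, 'v) module" (structure) +
  assumes alternating: "x \<in> carrier A \<Longrightarrow> x \<otimes> x = \<zero>"
    and jacobi: "\<lbrakk>x \<in> carrier A; y \<in> carrier A; z \<in> carrier A\<rbrakk> \<Longrightarrow>
      ((x \<otimes> y) \<otimes> z) \<oplus> ((y \<otimes> z) \<otimes> x) \<oplus> ((z \<otimes> x) \<otimes> y) = \<zero>"

definition commutator_algebra :: "('k::field, 'v) module \<Rightarrow> ('k, 'v) module" where
  "commutator_algebra A =
     A\<lparr>monoid.mult := (\<lambda>x y. (x \<otimes>\<^bsub>A\<^esub> y) \<ominus>\<^bsub>A\<^esub> (y \<otimes>\<^bsub>A\<^esub> x))\<rparr>"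

definition lie_admissible :: "('k::field, 'v) module \<Rightarrow> bool" where
  "lie_admissible A \<longleftrightarrow> nonassoc_algebra A \<and> lie_algebra (commutator_algebra A)"

primrec eval_mterm :: "('k::field, 'v) module \<Rightarrow> ('x \<Rightarrow> 'v) \<Rightarrow> 'x mterm \<Rightarrow> 'v" where
  "eval_mterm A \<rho> (Var x) = \<rho> x"
| "eval_mterm A \<rho> (App s t) = eval_mterm A \<rho> s \<otimes>\<^bsub>A\<^esub> eval_mterm A \<rho> t"

definition eval_poly ::
    "('k::field, 'v) module \<Rightarrow> ('x \<Rightarrow> 'v) \<Rightarrow> ('x mterm \<Rightarrow>\<^sub>0 'k) \<Rightarrow> 'v" where
  "eval_poly A \<rho> f =
     (\<Oplus>\<^bsub>A\<^esub>t\<in>Poly_Mapping.keys f. Poly_Mapping.lookup f t \<odot>\<^bsub>A\<^esub> eval_mterm A \<rho> t)"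

text \<open>Algebras over the operad \<open>Mag / P\<close>.\<close>

definition operad_algebra ::
    "(nat \<Rightarrow> (nat mterm \<Rightarrow>\<^sub>0 'k::field) set) \<Rightarrow> ('k, 'v) module \<Rightarrow> bool" where
  "operad_algebra P A \<longleftrightarrow> nonassoc_algebra A \<and>
     (\<forall>n. \<forall>f\<in>P n. \<forall>\<rho>. (\<forall>i. \<rho> i \<in> carrier A) \<longrightarrow> eval_poly A \<rho> f = \<zero>\<^bsub>A\<^esub>)"


section \<open>Tensor products\<close>

text \<open>\<open>S \<otimes> U\<close> is the free vector space on \<open>carrier S \<times> carrier U\<close> modulo the span of the
  bilinearity relations, with product \<open>(a \<otimes> u)(b \<otimes> v) = ab \<otimes> uv\<close>. As in the library's quotient
  constructions, an operation on cosets is the union of the cosets of all results on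
  representatives.\<close>

definition tensor_free ::
    "('k::field, 's) module \<Rightarrow> ('k, 'u) module \<Rightarrow> ('s \<times> 'u \<Rightarrow>\<^sub>0 'k) set" where
  "tensor_free S U = {f. Poly_Mapping.keys f \<subseteq> carrier S \<times> carrier U}"

definition tensor_null ::
    "('k::field, 's) module \<Rightarrow> ('k, 'u) module \<Rightarrow> ('s \<times> 'u \<Rightarrow>\<^sub>0 'k) set" where
  "tensor_null S U = fvs.span
     ({Poly_Mapping.single (a \<oplus>\<^bsub>S\<^esub> b, u) 1 - Poly_Mapping.single (a, u) 1 - Poly_Mapping.single (b, u) 1
         | a b u. a \<in> carrier S \<and> b \<in> carrier S \<and> u \<in> carrier U} \<union>
      {Poly_Mapping.single (a, u \<oplus>\<^bsub>U\<^esub> v) 1 - Poly_Mapping.single (a, u) 1 - Poly_Mapping.single (a, v) 1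
         | a u v. a \<in> carrier S \<and> u \<in> carrier U \<and> v \<in> carrier U} \<union>
      {Poly_Mapping.single (c \<odot>\<^bsub>S\<^esub> a, u) 1 - Poly_Mapping.single (a, u) c
         | c a u. a \<in> carrier S \<and> u \<in> carrier U} \<union>
      {Poly_Mapping.single (a, c \<odot>\<^bsub>U\<^esub> u) 1 - Poly_Mapping.single (a, u) c
         | c a u. a \<in> carrier S \<and> u \<in> carrier U})"

definition tensor_coset ::
    "('k::field, 's) module \<Rightarrow> ('k, 'u) module \<Rightarrow> ('s \<times> 'u \<Rightarrow>\<^sub>0 'k) \<Rightarrow> ('s \<times> 'u \<Rightarrow>\<^sub>0 'k) set" where
  "tensor_coset S U f = (\<lambda>r. f + r) ` tensor_null S U"

definition tensor_algebra ::
    "('k::field, 's) module \<Rightarrow> ('k, 'u) module \<Rightarrow> ('k, ('s \<times> 'u \<Rightarrow>\<^sub>0 'k) set) module" where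
  "tensor_algebra S U =
     \<lparr>carrier = tensor_coset S U ` tensor_free S U,
      monoid.mult = (\<lambda>F G. \<Union>f\<in>F. \<Union>g\<in>G. tensor_coset S U
        (bilin_ext (\<lambda>(a, u) (b, v). (a \<otimes>\<^bsub>S\<^esub> b, u \<otimes>\<^bsub>U\<^esub> v)) f g)),
      one = undefined,
      ring.zero = tensor_coset S U 0,
      add = (\<lambda>F G. \<Union>f\<in>F. \<Union>g\<in>G. tensor_coset S U (f + g)),
      module.smult = (\<lambda>c F. \<Union>f\<in>F. tensor_coset S U (fscale c f))\<rparr>"


section \<open>Koszul duals\<close>

text \<open>\<open>Mag / Q\<close> is the Koszul dual of the quadratic operad \<open>Mag / P\<close>. Algebras have
  their carriers in the type \<open>'v\<close>; this has to be a type that can carry nonzero vector spaces,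
  i.e. that has at least the cardinality of the field. For an infinite field every such type
  accommodates all vector spaces of countable dimension.\<close>

definition is_koszul_dual ::
    "'v itself \<Rightarrow> (nat \<Rightarrow> (nat mterm \<Rightarrow>\<^sub>0 'k::field) set) \<Rightarrow> (nat \<Rightarrow> (nat mterm \<Rightarrow>\<^sub>0 'k) set) \<Rightarrow> bool"
  where
  "is_koszul_dual v P Q \<longleftrightarrow> operadic_ideal Q \<and>
     (\<forall>U :: ('k, 'v) module. nonassoc_algebra U \<longrightarrow>
        (operad_algebra Q U \<longleftrightarrow>
         (\<forall>S :: ('k, 'v) module. operad_algebra P S \<longrightarrow> lie_admissible (tensor_algebra S U))))"


section \<open>Initial commutative dialgebras and Lie-admissible algebras\<close>

text \<open>The generating operation is \<open>\<stileturn>\<close>, and \<open>\<turnstile>\<close> is eliminated by \<open>a \<turnstile> b = b \<stileturn> a\<close>.\<close>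

abbreviation di_left :: "'x mterm \<Rightarrow> 'x mterm \<Rightarrow> 'x mterm" (infix \<open>\<stileturn>\<close> 70) where
  "a \<stileturn> b \<equiv> App a b"

abbreviation di_right :: "'x mterm \<Rightarrow> 'x mterm \<Rightarrow> 'x mterm" (infix \<open>\<turnstile>\<close> 70) where
  "a \<turnstile> b \<equiv> b \<stileturn> a"

definition identity :: "'x mterm \<Rightarrow> 'x mterm \<Rightarrow> ('x mterm \<Rightarrow>\<^sub>0 'k::field)" where
  "identity s t = Poly_Mapping.single s 1 - Poly_Mapping.single t 1"

definition diCom_I_relations :: "(nat mterm \<Rightarrow>\<^sub>0 'k::field) set" where
  "diCom_I_relations = (let a = Var 0; b = Var 1; c = Var 2 in
     {identity (a \<stileturn> (b \<stileturn> c)) (a \<stileturn> (b \<turnstile> c)),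
      identity ((a \<turnstile> b) \<turnstile> c) ((a \<stileturn> b) \<turnstile> c),
      identity ((a \<stileturn> b) \<stileturn> c) (a \<stileturn> (b \<stileturn> c)),
      identity ((a \<turnstile> b) \<stileturn> c) (a \<turnstile> (b \<stileturn> c)),
      identity ((a \<turnstile> b) \<turnstile> c) (a \<turnstile> (b \<turnstile> c)),
      identity ((a \<turnstile> b) \<turnstile> c) (a \<stileturn> (b \<stileturn> c))})"

definition diCom_I :: "nat \<Rightarrow> (nat mterm \<Rightarrow>\<^sub>0 'k::field) set" where
  "diCom_I = quadratic_operad diCom_I_relations"

definition commutator ::
    "('x mterm \<Rightarrow>\<^sub>0 'k::field) \<Rightarrow> ('x mterm \<Rightarrow>\<^sub>0 'k) \<Rightarrow> ('x mterm \<Rightarrow>\<^sub>0 'k)" where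
  "commutator f g = bilin_ext App f g - bilin_ext App g f"

definition commutator_jacobi :: "nat mterm \<Rightarrow>\<^sub>0 'k::field" where
  "commutator_jacobi =
     (let u = Poly_Mapping.single (Var 0) 1;
          v = Poly_Mapping.single (Var 1) 1;
          w = Poly_Mapping.single (Var 2) 1
      in commutator (commutator u v) w + commutator (commutator v w) u + commutator (commutator w u) v)"

definition LieAdm :: "nat \<Rightarrow> (nat mterm \<Rightarrow>\<^sub>0 'k::field) set" where
  "LieAdm = quadratic_operad {commutator_jacobi}"

end

theory Submission
  imports Defs "HOL-Library.Countable"
begin

text \<open>In an initial commutative dialgebra \<open>S\<close> all products of three given elements agree, so the
  Jacobi expression of the commutator of \<open>S \<otimes> U\<close> at \<open>a\<^sub>i \<otimes> u\<^sub>i\<close> is \<open>a\<^sub>0a\<^sub>1a\<^sub>2\<close> tensored with the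
  Jacobi expression of \<open>U\<close>. Hence \<open>S \<otimes> U\<close> is Lie-admissible if \<open>U\<close> is, and the choice \<open>S = K\<close>
  gives the converse. The dual operad is unique because an operadic ideal \<open>I\<close> can be read off from its
  algebras: it consists of the multilinear polynomials that vanish in the free algebra over
  \<open>Mag / I\<close> on countably many generators. Over a field of characteristic \<open>0\<close>, which is infinite, that
  algebra has the cardinality of the field and therefore fits into the given type.\<close>

text \<open>Products can be computed explicitly only at special elements: pure tensors in a tensor
  product, the unit in the ground field, monomials in a free algebra. In each case such elements are
  closed under multiplication, so all three algebras are treated as images of a free vector space on
  a magma, and a multilinear identity is tested on basis vectors alone.
  \<open>is_koszul_dual\<close> quantifies over algebras inside the fixed type \<open>'v\<close>.
  The ground field and the free algebra therefore have to be transported into \<open>'v\<close>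
  along an injection of the field, and the free algebra first needs an injection of its cosets into
  the field. The delicate point of uniqueness: an ideal contains multilinear polynomials only,
  whereas the kernel of the free algebra is spanned by all substitution instances, where variables
  may be repeated or renamed. One has to see that its multilinear part is no larger than the ideal.
  Multidegrees discard the instances that are not multilinear, and the others are obtained by
  composition and permutation.\<close>

abbreviation basis :: "'a \<Rightarrow> ('a \<Rightarrow>\<^sub>0 'k::field)" where
  "basis x \<equiv> Poly_Mapping.single x 1"

section \<open>Linear and bilinear extension from basis vectors\<close>

lemma fscale_single [simp]: "fscale c (Poly_Mapping.single x a) = Poly_Mapping.single x (c * a)"
  by (rule poly_mapping_eqI) (simp add: lookup_single when_def)

lemma keys_fscale: "Poly_Mapping.keys (fscale c f) \<subseteq> Poly_Mapping.keys f"
  by (auto simp: in_keys_iff)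

text \<open>Scaled basis vectors are stripped off one at a time without leaving the span of
  \<open>Y\<close>. This restriction is carried along because the algebra laws are later known only
  for vectors supported on carrier elements.\<close>

lemma poly_mapping_keys_induct [consumes 1, case_names zero add]:
  assumes "Poly_Mapping.keys f \<subseteq> Y" and "P 0"
    and add: "\<And>x c g. x \<in> Y \<Longrightarrow> Poly_Mapping.keys g \<subseteq> Y \<Longrightarrow> P g \<Longrightarrow> P (Poly_Mapping.single x c + g)"
  shows "P (f :: 'a \<Rightarrow>\<^sub>0 'k::field)"
  using assms(1)
proof (induction "card (Poly_Mapping.keys f)" arbitrary: f)
  case 0
  then show ?case using assms(2) by simp
next
  case (Suc n)
  then obtain x where x: "x \<in> Poly_Mapping.keys f" by fastforce
  define g where "g = f - Poly_Mapping.single x (Poly_Mapping.lookup f x)"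
  have k: "Poly_Mapping.keys g = Poly_Mapping.keys f - {x}"
    by (auto simp: g_def in_keys_iff lookup_minus lookup_single when_def split: if_splits)
  have "P g"
    using Suc x by (intro Suc.hyps(1)) (auto simp: k)
  then have "P (Poly_Mapping.single x (Poly_Mapping.lookup f x) + g)"
    using Suc.prems x by (intro add) (auto simp: k)
  then show ?case by (simp add: g_def)
qed

lemma poly_mapping_induct [case_names zero add]:
  assumes "P 0" and "\<And>x c g. P g \<Longrightarrow> P (Poly_Mapping.single x c + g)"
  shows "P (f :: 'a \<Rightarrow>\<^sub>0 'k::field)"
  using subset_UNIV assms by (rule poly_mapping_keys_induct)

text \<open>Cancellation can make the support of a sum smaller than the union of the supports.
  Summing over a common finite superset removes the dependence on it.\<close>

lemma lin_ext_superset: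
  assumes "finite B" "Poly_Mapping.keys f \<subseteq> B"
  shows "lin_ext h f = (\<Sum>x\<in>B. Poly_Mapping.single (h x) (Poly_Mapping.lookup f x))"
  unfolding lin_ext_def using assms by (intro sum.mono_neutral_left) (auto simp: in_keys_iff)

lemma lin_ext_add: "lin_ext h (f + g) = lin_ext h f + lin_ext h g"
proof -
  let ?B = "Poly_Mapping.keys f \<union> Poly_Mapping.keys g"
  have "Poly_Mapping.keys (f + g) \<subseteq> ?B" by (rule keys_add)
  then show ?thesis
    by (simp add: lin_ext_superset[of ?B] lookup_add single_add sum.distrib)
qed

lemma lin_ext_fscale: "lin_ext h (fscale c f) = fscale c (lin_ext h f)"
  using keys_fscale[of c f]
  by (simp add: lin_ext_superset[of "Poly_Mapping.keys f"] fvs.scale_sum_right)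

lemma lin_ext_zero [simp]: "lin_ext h 0 = 0"
  by (simp add: lin_ext_def)

lemma lin_ext_single [simp]: "lin_ext h (Poly_Mapping.single x c) = Poly_Mapping.single (h x) c"
  by (simp add: lin_ext_def)

lemma lin_ext_diff: "lin_ext h (f - g) = lin_ext h f - lin_ext h g"
  using lin_ext_add[of h "f - g" g] by (simp add: algebra_simps)

lemma lin_ext_cong:
  "(\<And>x. x \<in> Poly_Mapping.keys f \<Longrightarrow> h x = h' x) \<Longrightarrow> lin_ext h f = lin_ext h' f"
  by (simp add: lin_ext_def)

lemma lin_ext_lin_ext: "lin_ext h (lin_ext h' f) = lin_ext (\<lambda>x. h (h' x)) f"
  by (induction f rule: poly_mapping_induct) (simp_all add: lin_ext_add)

lemma keys_lin_ext: "Poly_Mapping.keys (lin_ext h f) \<subseteq> h ` Poly_Mapping.keys f"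
  unfolding lin_ext_def by (rule order_trans[OF keys_sum]) (auto split: if_splits)

lemma bilin_ext_superset:
  assumes "finite B" "Poly_Mapping.keys f \<subseteq> B" "finite C" "Poly_Mapping.keys g \<subseteq> C"
  shows "bilin_ext h f g = (\<Sum>x\<in>B. \<Sum>y\<in>C.
    Poly_Mapping.single (h x y) (Poly_Mapping.lookup f x * Poly_Mapping.lookup g y))"
proof -
  have "bilin_ext h f g = (\<Sum>x\<in>Poly_Mapping.keys f. \<Sum>y\<in>C.
    Poly_Mapping.single (h x y) (Poly_Mapping.lookup f x * Poly_Mapping.lookup g y))"
    unfolding bilin_ext_def using assms
    by (intro sum.cong refl sum.mono_neutral_left) (auto simp: in_keys_iff)
  also have "\<dots> = (\<Sum>x\<in>B. \<Sum>y\<in>C.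
    Poly_Mapping.single (h x y) (Poly_Mapping.lookup f x * Poly_Mapping.lookup g y))"
    using assms by (intro sum.mono_neutral_left) (auto simp: in_keys_iff)
  finally show ?thesis .
qed

lemma bilin_ext_add_left: "bilin_ext h (f + f') g = bilin_ext h f g + bilin_ext h f' g"
proof -
  let ?B = "Poly_Mapping.keys f \<union> Poly_Mapping.keys f'"
  have "Poly_Mapping.keys (f + f') \<subseteq> ?B" by (rule keys_add)
  then show ?thesis
    by (simp add: bilin_ext_superset[of ?B _ "Poly_Mapping.keys g"] lookup_add single_add
        sum.distrib distrib_right)
qed

lemma bilin_ext_flip: "bilin_ext h f g = bilin_ext (\<lambda>x y. h y x) g f"
  unfolding bilin_ext_def by (subst sum.swap) (simp add: mult.commute)

lemma bilin_ext_add_right: "bilin_ext h f (g + g') = bilin_ext h f g + bilin_ext h f g'"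
  by (metis bilin_ext_flip bilin_ext_add_left)

lemma bilin_ext_fscale_left: "bilin_ext h (fscale c f) g = fscale c (bilin_ext h f g)"
  using keys_fscale[of c f]
  by (simp add: bilin_ext_superset[of "Poly_Mapping.keys f" _ "Poly_Mapping.keys g"]
      fvs.scale_sum_right mult.assoc)

lemma bilin_ext_fscale_right: "bilin_ext h f (fscale c g) = fscale c (bilin_ext h f g)"
  by (metis bilin_ext_flip bilin_ext_fscale_left)

lemma bilin_ext_zero [simp]: "bilin_ext h 0 g = 0" "bilin_ext h f 0 = 0"
  by (simp_all add: bilin_ext_def)

lemma bilin_ext_diff_left: "bilin_ext h (f - f') g = bilin_ext h f g - bilin_ext h f' g"
  using bilin_ext_add_left[of h "f - f'" f' g] by (simp add: algebra_simps)

lemma bilin_ext_diff_right: "bilin_ext h f (g - g') = bilin_ext h f g - bilin_ext h f g'"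
  using bilin_ext_add_right[of h f "g - g'" g'] by (simp add: algebra_simps)

lemma bilin_ext_single [simp]:
  "bilin_ext h (Poly_Mapping.single x a) (Poly_Mapping.single y b) = Poly_Mapping.single (h x y) (a * b)"
  by (simp add: bilin_ext_def)

lemma bilin_ext_single_left:
  "bilin_ext h (Poly_Mapping.single x c) g = fscale c (lin_ext (h x) g)"
  by (induction g rule: poly_mapping_induct)
    (simp_all add: bilin_ext_add_right lin_ext_add fvs.scale_right_distrib)

lemma bilin_ext_single_right:
  "bilin_ext h f (Poly_Mapping.single y c) = fscale c (lin_ext (\<lambda>x. h x y) f)"
  by (subst bilin_ext_flip) (rule bilin_ext_single_left)

lemma keys_bilin_ext:
  "Poly_Mapping.keys (bilin_ext h f g)
    \<subseteq> (\<lambda>(x, y). h x y) ` (Poly_Mapping.keys f \<times> Poly_Mapping.keys g)"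
proof -
  have "Poly_Mapping.keys (bilin_ext h f g) \<subseteq> (\<Union>x\<in>Poly_Mapping.keys f. \<Union>y\<in>Poly_Mapping.keys g.
      Poly_Mapping.keys (Poly_Mapping.single (h x y) (Poly_Mapping.lookup f x * Poly_Mapping.lookup g y)))"
    unfolding bilin_ext_def
    by (intro order_trans[OF keys_sum] UN_mono order_refl)
  then show ?thesis by (auto split: if_splits)
qed

lemma subspace_keys: "fvs.subspace {f :: 'a \<Rightarrow>\<^sub>0 'k::field. Poly_Mapping.keys f \<subseteq> Y}"
proof -
  have "Poly_Mapping.keys (f + g) \<subseteq> Y" "Poly_Mapping.keys (fscale c f) \<subseteq> Y"
    if "Poly_Mapping.keys f \<subseteq> Y" "Poly_Mapping.keys g \<subseteq> Y" for c and f g :: "'a \<Rightarrow>\<^sub>0 'k"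
    using that keys_add[of f g] keys_fscale[of c f] by blast+
  then show ?thesis by (auto simp: fvs.subspace_def)
qed

section \<open>Multilinear polynomials\<close>

lemma leaves_nonempty [simp]: "leaves t \<noteq> []"
  by (induction t) auto

lemma leaves_subst: "leaves (mterm_subst \<sigma> t) = concat (map (\<lambda>x. leaves (\<sigma> x)) (leaves t))"
  by (induction t) auto

lemma leaves_map: "leaves (map_mterm h t) = map h (leaves t)"
  by (induction t) auto

lemma map_mterm_conv_subst: "map_mterm h t = mterm_subst (\<lambda>x. Var (h x)) t"
  by (induction t) auto

lemma mterm_subst_subst: "mterm_subst \<sigma> (mterm_subst \<tau> t) = mterm_subst (\<lambda>x. mterm_subst \<sigma> (\<tau> x)) t"
  by (induction t) auto

lemma mterm_subst_cong:
  "(\<And>x. x \<in> set (leaves t) \<Longrightarrow> \<sigma> x = \<tau> x) \<Longrightarrow> mterm_subst \<sigma> t = mterm_subst \<tau> t"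
  by (induction t) auto

lemma mterm_subst_Var [simp]: "mterm_subst Var t = t"
  by (induction t) auto

lemma keys_Mag:
  assumes "f \<in> Mag n" "t \<in> Poly_Mapping.keys f"
  shows "distinct (leaves t)" "set (leaves t) = {..<n}"
  using assms by (auto simp: Mag_def)

lemma subspace_Mag: "fvs.subspace (Mag n :: (nat mterm \<Rightarrow>\<^sub>0 'k::field) set)"
proof -
  have "Mag n = {f :: nat mterm \<Rightarrow>\<^sub>0 'k. Poly_Mapping.keys f \<subseteq> {t. distinct (leaves t) \<and> set (leaves t) = {..<n}}}"
    by (auto simp: Mag_def)
  then show ?thesis by (simp only: subspace_keys)
qed

lemma single_in_Mag:
  "distinct (leaves t) \<Longrightarrow> set (leaves t) = {..<n} \<Longrightarrow> Poly_Mapping.single t c \<in> Mag n"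
  by (simp add: Mag_def)

text \<open>Leaf \<open>j\<close> of \<open>s\<close> is replaced by a block of variables:
  \<open>{j}\<close> before the slot, an interval of length \<open>n\<close> at the slot,
  \<open>{j + n - 1}\<close> after it. These blocks are disjoint and fill
  \<open>{..<m + n - 1}\<close>.\<close>

lemma mterm_comp_multilinear:
  assumes s: "distinct (leaves s)" "set (leaves s) = {..<m}"
    and t: "distinct (leaves t)" "set (leaves t) = {..<n}" and i: "i < m"
  shows "distinct (leaves (mterm_comp i n s t))"
    and "set (leaves (mterm_comp i n s t)) = {..<m + n - 1}"
proof -
  define \<sigma> where "\<sigma> = (\<lambda>j. if j < i then Var j
          else if j = i then map_mterm (\<lambda>k. i + k) t else Var (j + n - 1))"
  define L where "L j = leaves (\<sigma> j)" for j
  have comp: "leaves (mterm_comp i n s t) = concat (map L (leaves s))"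
    unfolding mterm_comp_def leaves_subst L_def \<sigma>_def ..
  have n: "n > 0" using t(2) leaves_nonempty[of t] by (cases n) auto
  have Li: "L i = map (\<lambda>k. i + k) (leaves t)" by (simp add: L_def \<sigma>_def leaves_map)
  have L1: "L j = [j]" if "j < i" for j using that by (simp add: L_def \<sigma>_def)
  have L2: "L j = [j + n - 1]" if "j > i" for j using that by (simp add: L_def \<sigma>_def)
  have Lset: "set (L i) = {i..<i + n}"
  proof -
    have "set (L i) = (\<lambda>k. i + k) ` {..<n}" by (simp add: Li t)
    also have "\<dots> = {i..<i + n}"
      by (simp add: lessThan_atLeast0 image_add_atLeastLessThan add.commute)
    finally show ?thesis .
  qed
  have LLset: "set (L j) = (if j < i then {j} else if j = i then {i..<i + n} else {j + n - 1})" for j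
    using L1[of j] L2[of j] Lset by (cases "j < i"; cases "j = i") auto
  have LLd: "distinct (L j)" for j
    using L1[of j] L2[of j] t(1) by (cases "j < i"; cases "j = i") (auto simp: Li distinct_map)
  have disj: "set (L j) \<inter> set (L k) = {}" if "j \<noteq> k" for j k
    using that n by (auto simp: LLset)
  have "distinct (concat (map L xs))" if "distinct xs" for xs
    using that
  proof (induction xs)
    case (Cons x xs)
    have "set (L x) \<inter> set (L k) = {}" if "k \<in> set xs" for k
      using that Cons.prems by (intro disj) auto
    then show ?case using Cons LLd by auto
  qed simp
  then show "distinct (leaves (mterm_comp i n s t))" using s by (simp add: comp)
  have "set (leaves (mterm_comp i n s t)) = (\<Union>j<m. set (L j))" by (simp add: comp s)
  also have "\<dots> = {..<m + n - 1}"
  proof (intro equalityI subsetI)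
    fix x assume "x \<in> (\<Union>j<m. set (L j))"
    then show "x \<in> {..<m + n - 1}" using i n by (auto simp: LLset split: if_splits)
  next
    fix x assume x: "x \<in> {..<m + n - 1}"
    \<comment> \<open>The index of the block that contains \<open>x\<close>: positions past the
      interval are shifted back by \<open>n - 1\<close>.\<close>
    define j where "j = (if x < i then x else if x < i + n then i else x - (n - 1))"
    have "j < m" "x \<in> set (L j)" using x i n by (auto simp: j_def LLset)
    then show "x \<in> (\<Union>j<m. set (L j))" by auto
  qed
  finally show "set (leaves (mterm_comp i n s t)) = {..<m + n - 1}" .
qed

lemma mag_comp_in_Mag:
  assumes "f \<in> Mag m" "g \<in> Mag n" "i < m"
  shows "mag_comp i n f g \<in> Mag (m + n - 1)"
  unfolding Mag_def mag_comp_def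
proof safe
  fix u assume "u \<in> Poly_Mapping.keys (bilin_ext (mterm_comp i n) f g)"
  then obtain s t where st: "u = mterm_comp i n s t" "s \<in> Poly_Mapping.keys f" "t \<in> Poly_Mapping.keys g"
    using keys_bilin_ext by fastforce
  note * = mterm_comp_multilinear[OF keys_Mag[OF assms(1) st(2)] keys_Mag[OF assms(2) st(3)] assms(3)]
  show "distinct (leaves u)" using * st by simp
  show "\<And>x. x \<in> set (leaves u) \<Longrightarrow> x < m + n - 1" using * st by auto
  show "\<And>x. x < m + n - 1 \<Longrightarrow> x \<in> set (leaves u)" using * st by auto
qed

lemma operadic_ideal_subset: "operadic_ideal I \<Longrightarrow> I n \<subseteq> Mag n"
  and operadic_ideal_subspace: "operadic_ideal I \<Longrightarrow> fvs.subspace (I n)"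
  and operadic_ideal_permute:
    "operadic_ideal I \<Longrightarrow> f \<in> I n \<Longrightarrow> \<pi> permutes {..<n} \<Longrightarrow> lin_ext (map_mterm \<pi>) f \<in> I n"
  and operadic_ideal_comp_left:
    "operadic_ideal I \<Longrightarrow> i < m \<Longrightarrow> f \<in> I m \<Longrightarrow> g \<in> Mag n \<Longrightarrow> mag_comp i n f g \<in> I (m + n - 1)"
  and operadic_ideal_comp_right:
    "operadic_ideal I \<Longrightarrow> i < m \<Longrightarrow> f \<in> Mag m \<Longrightarrow> g \<in> I n \<Longrightarrow> mag_comp i n f g \<in> I (m + n - 1)"
  unfolding operadic_ideal_def by blast+

text \<open>Ensures that the intersection defining \<open>quadratic_operad R\<close> runs over a
  nonempty family when \<open>R\<close> lies in \<open>Mag 3\<close>, and hence stays inside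
  \<open>Mag\<close>.\<close>

lemma operadic_ideal_Mag: "operadic_ideal Mag"
  unfolding operadic_ideal_def
proof (intro conjI allI impI)
  fix n and f :: "nat mterm \<Rightarrow>\<^sub>0 'a" and \<pi> assume f: "f \<in> Mag n" and p: "\<pi> permutes {..<n}"
  show "lin_ext (map_mterm \<pi>) f \<in> Mag n"
    unfolding Mag_def
  proof safe
    fix t assume "t \<in> Poly_Mapping.keys (lin_ext (map_mterm \<pi>) f)"
    then obtain s where s: "t = map_mterm \<pi> s" "s \<in> Poly_Mapping.keys f"
      using keys_lin_ext by fastforce
    note k = keys_Mag[OF f s(2)]
    show "distinct (leaves t)"
      using k permutes_inj[OF p] by (auto simp: s leaves_map distinct_map intro: inj_on_subset)
    have "set (leaves t) = {..<n}"
      using k permutes_image[OF p] by (simp add: s leaves_map)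
    then show "\<And>x. x \<in> set (leaves t) \<Longrightarrow> x < n" "\<And>x. x < n \<Longrightarrow> x \<in> set (leaves t)" by auto
  qed
qed (simp_all only: subset_refl subspace_Mag mag_comp_in_Mag)

lemma quadratic_operad_relations: "R \<subseteq> quadratic_operad R 3"
  by (auto simp: quadratic_operad_def)

lemma quadratic_operad_minimal: "operadic_ideal I \<Longrightarrow> R \<subseteq> I 3 \<Longrightarrow> quadratic_operad R n \<subseteq> I n"
  by (auto simp: quadratic_operad_def)

lemma operadic_ideal_quadratic_operad:
  assumes "R \<subseteq> Mag 3"
  shows "operadic_ideal (quadratic_operad R)"
  unfolding operadic_ideal_def
proof (intro conjI allI impI)
  fix n
  show "quadratic_operad R n \<subseteq> Mag n"
    using assms by (intro quadratic_operad_minimal operadic_ideal_Mag)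
  show "fvs.subspace (quadratic_operad R n)"
    unfolding quadratic_operad_def by (intro fvs.subspace_Inter) (auto simp: operadic_ideal_def)
next
  fix n f \<pi> assume "f \<in> quadratic_operad R n" "\<pi> permutes {..<n}"
  then show "lin_ext (map_mterm \<pi>) f \<in> quadratic_operad R n"
    unfolding quadratic_operad_def operadic_ideal_def by blast
next
  fix m n i f g
  assume *: "i < m" "f \<in> Mag m" "g \<in> Mag n" "f \<in> quadratic_operad R m \<or> g \<in> quadratic_operad R n"
  show "mag_comp i n f g \<in> quadratic_operad R (m + n - 1)"
    unfolding quadratic_operad_def
  proof safe
    fix I assume I: "operadic_ideal I" "R \<subseteq> I 3"
    then have "f \<in> I m \<or> g \<in> I n" using * quadratic_operad_minimal by blast
    then show "mag_comp i n f g \<in> I (m + n - 1)"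
      using I(1) * unfolding operadic_ideal_def by blast
  qed
qed

section \<open>Linear combinations in algebras\<close>

text \<open>Generalises \<open>eval_poly\<close> to arbitrary index types. Besides monomials,
  two-element label sets and pairs serve as indices below.\<close>

definition lincomb :: "('k::field, 'v) module \<Rightarrow> ('a \<Rightarrow> 'v) \<Rightarrow> ('a \<Rightarrow>\<^sub>0 'k) \<Rightarrow> 'v" where
  "lincomb A v f = (\<Oplus>\<^bsub>A\<^esub>x\<in>Poly_Mapping.keys f. Poly_Mapping.lookup f x \<odot>\<^bsub>A\<^esub> v x)"

definition linear_into :: "('k::field, 'v) module \<Rightarrow> (('a \<Rightarrow>\<^sub>0 'k) \<Rightarrow> 'v) \<Rightarrow> bool" where
  "linear_into A \<phi> \<longleftrightarrow> (\<forall>f. \<phi> f \<in> carrier A) \<and> (\<forall>f g. \<phi> (f + g) = \<phi> f \<oplus>\<^bsub>A\<^esub> \<phi> g) \<and>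
     (\<forall>c f. \<phi> (fscale c f) = c \<odot>\<^bsub>A\<^esub> \<phi> f)"

lemma eval_poly_lincomb: "eval_poly A \<rho> = lincomb A (eval_mterm A \<rho>)"
  by (rule ext) (simp add: eval_poly_def lincomb_def)

lemma type_ring_simps [simp]:
  "carrier ring_of_type_algebra = UNIV"
  "x \<oplus>\<^bsub>ring_of_type_algebra\<^esub> y = x + y" "x \<otimes>\<^bsub>ring_of_type_algebra\<^esub> y = x * y"
  "\<zero>\<^bsub>ring_of_type_algebra\<^esub> = 0" "\<one>\<^bsub>ring_of_type_algebra\<^esub> = 1"
  by (simp_all add: ring_of_type_algebra_def)

context nonassoc_algebra
begin

lemma smult_in [simp, intro]: "x \<in> carrier A \<Longrightarrow> c \<odot> x \<in> carrier A"
  using smult_closed[of c x] by simp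

lemma smult_add_left: "x \<in> carrier A \<Longrightarrow> (a + b) \<odot> x = a \<odot> x \<oplus> b \<odot> x"
  using smult_l_distr[of a b x] by simp

lemma smult_add_right: "x \<in> carrier A \<Longrightarrow> y \<in> carrier A \<Longrightarrow> a \<odot> (x \<oplus> y) = a \<odot> x \<oplus> a \<odot> y"
  using smult_r_distr[of a x y] by simp

lemma smult_smult: "x \<in> carrier A \<Longrightarrow> a \<odot> (b \<odot> x) = (a * b) \<odot> x"
  using smult_assoc1[of a b x] by simp

lemma smult_1 [simp]: "x \<in> carrier A \<Longrightarrow> 1 \<odot> x = x"
  using smult_one[of x] by simp

lemma smult_0 [simp]: "x \<in> carrier A \<Longrightarrow> 0 \<odot> x = \<zero>"
  using smult_l_null[of x] by simp

lemma smult_zero [simp]: "a \<odot> \<zero> = \<zero>"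
  using smult_r_null[of a] by simp

lemma smult_neg_1: "x \<in> carrier A \<Longrightarrow> (- 1) \<odot> x = \<ominus> x"
  using smult_add_left[of x "- 1" 1] M.minus_equality[of "(- 1) \<odot> x" x] by simp

lemmas mult_in [simp, intro] = mult_closed

lemma linear_into_zero: "linear_into A \<phi> \<Longrightarrow> \<phi> 0 = \<zero>"
  unfolding linear_into_def by (metis fvs.scale_zero_left smult_0)

text \<open>The uniqueness half of the universal property of a free vector space; the laws of
  \<open>lincomb\<close> below are reduced to basis vectors by it.\<close>

lemma linear_into_eqI:
  assumes "linear_into A \<phi>" "linear_into A \<psi>" "\<And>x. \<phi> (basis x) = \<psi> (basis x)"
  shows "\<phi> f = \<psi> f"
proof (induction f rule: poly_mapping_induct)
  case zero
  show ?case using assms(1,2) by (simp add: linear_into_zero)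
next
  case (add x c g)
  have "\<phi> (Poly_Mapping.single x c) = \<psi> (Poly_Mapping.single x c)"
    using assms fscale_single[of c x 1] unfolding linear_into_def by (metis mult.right_neutral)
  then show ?case using assms(1,2) add unfolding linear_into_def by metis
qed

lemma lincomb_superset:
  assumes "range v \<subseteq> carrier A" "finite B" "Poly_Mapping.keys f \<subseteq> B"
  shows "lincomb A v f = (\<Oplus>x\<in>B. Poly_Mapping.lookup f x \<odot> v x)"
  unfolding lincomb_def
  using assms by (intro M.add.finprod_mono_neutral_cong_left) (auto simp: in_keys_iff image_subset_iff)

lemma linear_into_lincomb:
  fixes v :: "'a \<Rightarrow> 'v"
  assumes "range v \<subseteq> carrier A"
  shows "linear_into A (lincomb A v)"
  unfolding linear_into_def
proof safe
  have v: "v x \<in> carrier A" for x using assms by auto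
  fix f g :: "'a \<Rightarrow>\<^sub>0 'k" and c :: 'k
  show "lincomb A v f \<in> carrier A"
    unfolding lincomb_def using v by (intro M.finsum_closed) auto
  let ?B = "Poly_Mapping.keys f \<union> Poly_Mapping.keys g"
  have "Poly_Mapping.keys (f + g) \<subseteq> ?B" by (rule keys_add)
  then show "lincomb A v (f + g) = lincomb A v f \<oplus> lincomb A v g"
    using v by (simp add: lincomb_superset[OF assms, of ?B] lookup_add smult_add_left M.finsum_addf)
  have "lincomb A v (fscale c f)
      = (\<Oplus>x\<in>Poly_Mapping.keys f. c \<odot> (Poly_Mapping.lookup f x \<odot> v x))"
    using v keys_fscale[of c f]
    by (simp add: lincomb_superset[OF assms, of "Poly_Mapping.keys f"] smult_smult)
  also have "\<dots> = c \<odot> lincomb A v f"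
    unfolding lincomb_def using v
    by (subst finsum_smult_ldistr) auto
  finally show "lincomb A v (fscale c f) = c \<odot> lincomb A v f" .
qed

lemma lincomb_single [simp]: "v x \<in> carrier A \<Longrightarrow> lincomb A v (Poly_Mapping.single x c) = c \<odot> v x"
  by (simp add: lincomb_def M.finsum_empty M.finsum_insert)

lemma lincomb_closed: "range v \<subseteq> carrier A \<Longrightarrow> lincomb A v f \<in> carrier A"
  using linear_into_lincomb unfolding linear_into_def by blast

lemma lincomb_add: "range v \<subseteq> carrier A \<Longrightarrow> lincomb A v (f + g) = lincomb A v f \<oplus> lincomb A v g"
  using linear_into_lincomb unfolding linear_into_def by blast

lemma lincomb_fscale: "range v \<subseteq> carrier A \<Longrightarrow> lincomb A v (fscale c f) = c \<odot> lincomb A v f"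
  using linear_into_lincomb unfolding linear_into_def by blast

lemma lincomb_zero [simp]: "lincomb A v 0 = \<zero>"
  by (simp add: lincomb_def M.finsum_empty)

lemma lincomb_diff:
  assumes "range v \<subseteq> carrier A"
  shows "lincomb A v (f - g) = lincomb A v f \<ominus> lincomb A v g"
proof -
  have "f - g = f + fscale (- 1) g" by (rule poly_mapping_eqI) (simp add: lookup_add lookup_minus)
  moreover have "lincomb A v (f + fscale (- 1) g) = lincomb A v f \<ominus> lincomb A v g"
    by (simp only: assms lincomb_add lincomb_fscale lincomb_closed smult_neg_1 M.minus_eq)
  ultimately show ?thesis by simp
qed

lemma lincomb_lin_ext:
  assumes "range v \<subseteq> carrier A"
  shows "lincomb A v (lin_ext h f) = lincomb A (\<lambda>x. v (h x)) f"
proof (rule linear_into_eqI)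
  show "linear_into A (\<lambda>f. lincomb A v (lin_ext h f))"
    using linear_into_lincomb[OF assms] by (simp add: linear_into_def lin_ext_add lin_ext_fscale)
  show "linear_into A (lincomb A (\<lambda>x. v (h x)))"
    using assms by (intro linear_into_lincomb) auto
  have v: "v x \<in> carrier A" for x using assms by auto
  show "lincomb A v (lin_ext h (basis x)) = lincomb A (\<lambda>x. v (h x)) (basis x)" for x
    using v by simp
qed

lemma lincomb_plus:
  assumes "range v \<subseteq> carrier A" "range w \<subseteq> carrier A"
  shows "lincomb A (\<lambda>x. v x \<oplus> w x) f = lincomb A v f \<oplus> lincomb A w f"
proof -
  have v: "v x \<in> carrier A" "w x \<in> carrier A" for x using assms by auto
  then show ?thesis by (simp add: lincomb_def smult_add_right M.finsum_addf)
qed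

lemma lincomb_smult:
  assumes "range v \<subseteq> carrier A"
  shows "lincomb A (\<lambda>x. c \<odot> v x) f = c \<odot> lincomb A v f"
proof -
  have v: "v x \<in> carrier A" for x using assms by auto
  have "c \<odot> lincomb A v f = (\<Oplus>x\<in>Poly_Mapping.keys f. c \<odot> (Poly_Mapping.lookup f x \<odot> v x))"
    unfolding lincomb_def using v by (subst finsum_smult_ldistr) auto
  then show ?thesis using v by (simp add: lincomb_def smult_smult mult.commute)
qed

lemma lincomb_cong:
  assumes "\<And>x. x \<in> Poly_Mapping.keys f \<Longrightarrow> v x = w x" "\<And>x. x \<in> Poly_Mapping.keys f \<Longrightarrow> w x \<in> carrier A"
  shows "lincomb A v f = lincomb A w f"
  unfolding lincomb_def using assms by (intro M.finsum_cong') auto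

lemma lincomb_bilin_ext:
  assumes "range v \<subseteq> carrier A"
  shows "lincomb A v (bilin_ext h f g) = lincomb A (\<lambda>x. lincomb A (\<lambda>y. v (h x y)) g) f"
proof (rule linear_into_eqI)
  have v: "v x \<in> carrier A" for x using assms by auto
  show "linear_into A (\<lambda>f. lincomb A v (bilin_ext h f g))"
    using linear_into_lincomb[OF assms]
    by (simp add: linear_into_def bilin_ext_add_left bilin_ext_fscale_left)
  have r: "range (\<lambda>x. lincomb A (\<lambda>y. v (h x y)) g) \<subseteq> carrier A"
    using v by (auto intro!: lincomb_closed)
  then show "linear_into A (lincomb A (\<lambda>x. lincomb A (\<lambda>y. v (h x y)) g))"
    by (rule linear_into_lincomb)
  show "lincomb A v (bilin_ext h (basis x) g) = lincomb A (\<lambda>x. lincomb A (\<lambda>y. v (h x y)) g) (basis x)"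
    for x
    using r v by (simp add: bilin_ext_single_left lincomb_lin_ext assms image_subset_iff)
qed

lemma mult_lincomb_right:
  assumes "range v \<subseteq> carrier A" "a \<in> carrier A"
  shows "a \<otimes> lincomb A v f = lincomb A (\<lambda>x. a \<otimes> v x) f"
proof (rule linear_into_eqI)
  have v: "v x \<in> carrier A" for x using assms by auto
  show "linear_into A (\<lambda>f. a \<otimes> lincomb A v f)"
    using assms by (simp add: linear_into_def lincomb_closed lincomb_add lincomb_fscale
        mult_add_right mult_smult_right)
  show "linear_into A (lincomb A (\<lambda>x. a \<otimes> v x))"
    using assms by (intro linear_into_lincomb) auto
  show "a \<otimes> lincomb A v (basis x) = lincomb A (\<lambda>x. a \<otimes> v x) (basis x)" for x
    using v assms by simp
qed

lemma mult_lincomb_left: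
  assumes "range v \<subseteq> carrier A" "a \<in> carrier A"
  shows "lincomb A v f \<otimes> a = lincomb A (\<lambda>x. v x \<otimes> a) f"
proof (rule linear_into_eqI)
  have v: "v x \<in> carrier A" for x using assms by auto
  show "linear_into A (\<lambda>f. lincomb A v f \<otimes> a)"
    using assms by (simp add: linear_into_def lincomb_closed lincomb_add lincomb_fscale
        mult_add_left mult_smult_left)
  show "linear_into A (lincomb A (\<lambda>x. v x \<otimes> a))"
    using assms by (intro linear_into_lincomb) auto
  show "lincomb A v (basis x) \<otimes> a = lincomb A (\<lambda>x. v x \<otimes> a) (basis x)" for x
    using v assms by simp
qed

section \<open>Evaluation of polynomials\<close>

lemma eval_mterm_closed [simp, intro]: "(\<And>i. \<rho> i \<in> carrier A) \<Longrightarrow> eval_mterm A \<rho> t \<in> carrier A"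
  by (induction t) auto

lemma eval_poly_closed [simp, intro]: "(\<And>i. \<rho> i \<in> carrier A) \<Longrightarrow> eval_poly A \<rho> f \<in> carrier A"
  unfolding eval_poly_lincomb by (intro lincomb_closed) auto

lemma eval_poly_App:
  assumes "\<And>i. \<rho> i \<in> carrier A"
  shows "eval_poly A \<rho> (bilin_ext App f g) = eval_poly A \<rho> f \<otimes> eval_poly A \<rho> g"
proof -
  have r: "range (eval_mterm A \<rho>) \<subseteq> carrier A" using assms by auto
  have c: "eval_mterm A \<rho> t \<in> carrier A" for t using assms by auto
  show ?thesis
    by (simp add: eval_poly_lincomb lincomb_bilin_ext r c mult_lincomb_right[symmetric]
        mult_lincomb_left lincomb_closed)
qed

lemma eval_poly_add:
  "(\<And>i. \<rho> i \<in> carrier A) \<Longrightarrow> eval_poly A \<rho> (f + g) = eval_poly A \<rho> f \<oplus> eval_poly A \<rho> g"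
  unfolding eval_poly_lincomb by (intro lincomb_add) auto

lemma eval_poly_fscale:
  "(\<And>i. \<rho> i \<in> carrier A) \<Longrightarrow> eval_poly A \<rho> (fscale c f) = c \<odot> eval_poly A \<rho> f"
  unfolding eval_poly_lincomb by (intro lincomb_fscale) auto

lemma eval_poly_diff:
  "(\<And>i. \<rho> i \<in> carrier A) \<Longrightarrow> eval_poly A \<rho> (f - g) = eval_poly A \<rho> f \<ominus> eval_poly A \<rho> g"
  unfolding eval_poly_lincomb by (intro lincomb_diff) auto

lemma eval_poly_basis: "(\<And>i. \<rho> i \<in> carrier A) \<Longrightarrow> eval_poly A \<rho> (basis t) = eval_mterm A \<rho> t"
  by (simp add: eval_poly_lincomb)

end

lemma eval_mterm_cong:
  "(\<And>x. x \<in> set (leaves t) \<Longrightarrow> \<rho> x = \<rho>' x) \<Longrightarrow> eval_mterm A \<rho> t = eval_mterm A \<rho>' t"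
  by (induction t) auto

lemma eval_mterm_subst:
  "eval_mterm A \<rho> (mterm_subst \<sigma> t) = eval_mterm A (\<lambda>x. eval_mterm A \<rho> (\<sigma> x)) t"
  by (induction t) auto

context nonassoc_algebra
begin

text \<open>A multilinear monomial contains \<open>i\<close> exactly once, so in each product one
  factor does not involve the value at \<open>i\<close> and the other is linear in it.\<close>

lemma eval_mterm_upd_lincomb:
  assumes "distinct (leaves t)" "i \<in> set (leaves t)" "\<And>j. \<rho> j \<in> carrier A" "range v \<subseteq> carrier A"
  shows "eval_mterm A (\<rho>(i := lincomb A v g)) t = lincomb A (\<lambda>x. eval_mterm A (\<rho>(i := v x)) t) g"
  using assms(1,2)
proof (induction t)
  case (Var x)
  then show ?case by simp
next
  case (App s t)
  have v: "v x \<in> carrier A" for x using assms by auto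
  have fresh: "eval_mterm A (\<rho>(i := y)) u = eval_mterm A \<rho> u" if "i \<notin> set (leaves u)" for u y
    using that by (intro eval_mterm_cong) auto
  have cl: "eval_mterm A (\<rho>(i := v x)) u \<in> carrier A" "eval_mterm A \<rho> u \<in> carrier A" for x u
    using v assms(3) by auto
  consider "i \<in> set (leaves s)" "i \<notin> set (leaves t)" | "i \<notin> set (leaves s)" "i \<in> set (leaves t)"
    using App.prems by auto
  then show ?case
  proof cases
    case 1
    then show ?thesis
      using App cl by (simp add: fresh mult_lincomb_left image_subset_iff del: fun_upd_apply)
  next
    case 2
    then show ?thesis
      using App cl by (simp add: fresh mult_lincomb_right image_subset_iff del: fun_upd_apply)
  qed
qed

text \<open>The monomials of \<open>f\<close> contain input \<open>i\<close> once, so the sum over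
  the monomials of \<open>g\<close> can be moved inside them.\<close>

lemma eval_poly_mag_comp:
  assumes "f \<in> Mag m" "i < m" "\<And>j. \<rho> j \<in> carrier A"
  shows "eval_poly A \<rho> (mag_comp i n f g) =
    eval_poly A ((\<lambda>j. if j < i then \<rho> j else \<rho> (j + n - 1))(i := eval_poly A (\<lambda>k. \<rho> (i + k)) g)) f"
proof -
  \<comment> \<open>Composition renames the inputs \<open>j\<close> of \<open>f\<close> after the
    slot to \<open>j + n - 1\<close>, and this is where \<open>\<rho>'\<close> looks them
    up.\<close>
  define \<rho>' where "\<rho>' = (\<lambda>j. if j < i then \<rho> j else \<rho> (j + n - 1))"
  define e where "e = eval_mterm A (\<lambda>k. \<rho> (i + k))"
  have c: "\<rho>' j \<in> carrier A" "e t \<in> carrier A" for j t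
    using assms(3) by (auto simp: \<rho>'_def e_def)
  have comp: "eval_mterm A \<rho> (mterm_comp i n s t) = eval_mterm A (\<rho>'(i := e t)) s" for s t
    unfolding mterm_comp_def eval_mterm_subst
    by (intro eval_mterm_cong)
      (auto simp: \<rho>'_def e_def map_mterm_conv_subst eval_mterm_subst)
  have "eval_poly A \<rho> (mag_comp i n f g)
      = lincomb A (\<lambda>s. lincomb A (\<lambda>t. eval_mterm A (\<rho>'(i := e t)) s) g) f"
    using assms(3) by (simp add: eval_poly_lincomb mag_comp_def lincomb_bilin_ext image_subset_iff comp)
  also have "\<dots> = lincomb A (\<lambda>s. eval_mterm A (\<rho>'(i := lincomb A e g)) s) f"
  proof (rule lincomb_cong)
    fix s assume "s \<in> Poly_Mapping.keys f"
    then show "lincomb A (\<lambda>t. eval_mterm A (\<rho>'(i := e t)) s) g = eval_mterm A (\<rho>'(i := lincomb A e g)) s"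
      using keys_Mag[OF assms(1)] assms(2) c
      by (subst eval_mterm_upd_lincomb) (auto simp: image_subset_iff)
    show "eval_mterm A (\<rho>'(i := lincomb A e g)) s \<in> carrier A"
      using c by (intro eval_mterm_closed) (auto intro!: lincomb_closed)
  qed
  finally show ?thesis by (simp add: eval_poly_lincomb \<rho>'_def e_def)
qed

section \<open>The multilinear identities of an algebra\<close>

definition relations :: "nat \<Rightarrow> (nat mterm \<Rightarrow>\<^sub>0 'k) set" where
  "relations n = {f \<in> Mag n. \<forall>\<rho>. (\<forall>i. \<rho> i \<in> carrier A) \<longrightarrow> eval_poly A \<rho> f = \<zero>}"

text \<open>Evaluation turns partial composition into insertion of a value. If \<open>f\<close> is
  an identity the inserted value is irrelevant; if \<open>g\<close> is one, the inserted value is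
  zero and multilinearity of \<open>f\<close> makes the result vanish.\<close>

lemma operadic_ideal_relations: "operadic_ideal relations"
  unfolding operadic_ideal_def
proof (intro conjI allI impI)
  fix n
  show "relations n \<subseteq> Mag n" by (auto simp: relations_def)
  have "eval_poly A \<rho> 0 = \<zero>" for \<rho> by (simp add: eval_poly_lincomb)
  then show "fvs.subspace (relations n)"
    using subspace_Mag[of n]
    by (auto simp: fvs.subspace_def relations_def eval_poly_add eval_poly_fscale)
next
  fix n f \<pi> assume f: "f \<in> relations n" and p: "\<pi> permutes {..<n}"
  have "lin_ext (map_mterm \<pi>) f \<in> Mag n"
    using f p by (intro operadic_ideal_permute operadic_ideal_Mag) (auto simp: relations_def)
  moreover have "eval_poly A \<rho> (lin_ext (map_mterm \<pi>) f) = eval_poly A (\<lambda>i. \<rho> (\<pi> i)) f"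
    if "\<forall>i. \<rho> i \<in> carrier A" for \<rho>
    using that
    by (simp add: eval_poly_lincomb lincomb_lin_ext image_subset_iff map_mterm_conv_subst eval_mterm_subst)
  ultimately show "lin_ext (map_mterm \<pi>) f \<in> relations n"
    using f by (auto simp: relations_def)
next
  fix m n i f g
  assume *: "i < m" "f \<in> Mag m" "g \<in> Mag n" "f \<in> relations m \<or> g \<in> relations n"
  have "eval_poly A \<rho> (mag_comp i n f g) = \<zero>" if \<rho>: "\<forall>i. \<rho> i \<in> carrier A" for \<rho>
  proof -
    define \<rho>' where "\<rho>' = (\<lambda>j. if j < i then \<rho> j else \<rho> (j + n - 1))"
    have \<rho>': "\<rho>' j \<in> carrier A" for j using \<rho> by (simp add: \<rho>'_def)
    have e: "eval_poly A \<rho> (mag_comp i n f g) = eval_poly A (\<rho>'(i := eval_poly A (\<lambda>k. \<rho> (i + k)) g)) f"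
      unfolding \<rho>'_def using * \<rho> by (intro eval_poly_mag_comp) auto
    from *(4) show ?thesis
    proof
      assume "f \<in> relations m"
      moreover have "\<forall>j. (\<rho>'(i := eval_poly A (\<lambda>k. \<rho> (i + k)) g)) j \<in> carrier A"
        using \<rho> \<rho>' by auto
      ultimately show ?thesis unfolding e relations_def by blast
    next
      assume "g \<in> relations n"
      \<comment> \<open>Zero is written as an empty linear combination, so that
        \<open>eval_mterm_upd_lincomb\<close> applies to it.\<close>
      then have "eval_poly A (\<lambda>k. \<rho> (i + k)) g = lincomb A \<rho> 0"
        using \<rho> by (simp add: relations_def)
      then have "eval_poly A \<rho> (mag_comp i n f g) = lincomb A (\<lambda>_. \<zero>) f"
        unfolding e using keys_Mag[OF *(2)] *(1) \<rho> \<rho>'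
        by (auto simp: eval_poly_lincomb eval_mterm_upd_lincomb image_subset_iff simp del: lincomb_zero
            intro!: lincomb_cong) simp_all
      also have "\<dots> = \<zero>"
        using lincomb_smult[of "\<lambda>_. \<zero>" 0 f] by (simp add: lincomb_closed)
      finally show ?thesis .
    qed
  qed
  then show "mag_comp i n f g \<in> relations (m + n - 1)"
    using mag_comp_in_Mag[OF *(2,3,1)] by (simp add: relations_def)
qed

text \<open>The generated ideal is the least one containing \<open>R\<close>, so it lies in the
  ideal of identities of \<open>A\<close> as soon as \<open>R\<close> does.\<close>

lemma operad_algebra_quadratic_iff:
  assumes "R \<subseteq> Mag 3"
  shows "operad_algebra (quadratic_operad R) A \<longleftrightarrow>
    (\<forall>f\<in>R. \<forall>\<rho>. (\<forall>i. \<rho> i \<in> carrier A) \<longrightarrow> eval_poly A \<rho> f = \<zero>)"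
proof
  assume "operad_algebra (quadratic_operad R) A"
  then show "\<forall>f\<in>R. \<forall>\<rho>. (\<forall>i. \<rho> i \<in> carrier A) \<longrightarrow> eval_poly A \<rho> f = \<zero>"
    using quadratic_operad_relations[of R] unfolding operad_algebra_def by blast
next
  assume "\<forall>f\<in>R. \<forall>\<rho>. (\<forall>i. \<rho> i \<in> carrier A) \<longrightarrow> eval_poly A \<rho> f = \<zero>"
  then have "R \<subseteq> relations 3" using assms by (auto simp: relations_def)
  then have "quadratic_operad R n \<subseteq> relations n" for n
    by (intro quadratic_operad_minimal operadic_ideal_relations)
  then show "operad_algebra (quadratic_operad R) A"
    unfolding operad_algebra_def relations_def using nonassoc_algebra_axioms by blast
qed

section \<open>Lie-admissibility as a polynomial identity\<close>

lemma eval_poly_commutator_jacobi: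
  assumes "\<And>i. \<rho> i \<in> carrier A"
  defines "x \<equiv> \<rho> 0" and "y \<equiv> \<rho> 1" and "z \<equiv> \<rho> 2"
  shows "eval_poly A \<rho> commutator_jacobi =
    (((x \<otimes> y \<ominus> y \<otimes> x) \<otimes> z) \<ominus> (z \<otimes> (x \<otimes> y \<ominus> y \<otimes> x))) \<oplus>
    (((y \<otimes> z \<ominus> z \<otimes> y) \<otimes> x) \<ominus> (x \<otimes> (y \<otimes> z \<ominus> z \<otimes> y))) \<oplus>
    (((z \<otimes> x \<ominus> x \<otimes> z) \<otimes> y) \<ominus> (y \<otimes> (z \<otimes> x \<ominus> x \<otimes> z)))"
  using assms(1)
  unfolding commutator_jacobi_def Let_def commutator_def x_def y_def z_def
  by (simp only: eval_poly_App eval_poly_add eval_poly_diff eval_poly_basis eval_mterm.simps)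

lemma commutator_mult: "x \<otimes>\<^bsub>commutator_algebra A\<^esub> y = x \<otimes> y \<ominus> y \<otimes> x"
  by (simp add: commutator_algebra_def)

lemma nonassoc_algebra_commutator: "nonassoc_algebra (commutator_algebra A)"
proof -
  interpret C: abelian_group "commutator_algebra A"
    using M.abelian_group_axioms
    unfolding commutator_algebra_def abelian_group_def abelian_monoid_def abelian_group_axioms_def
    by simp
  have s: "carrier (commutator_algebra A) = carrier A" "add (commutator_algebra A) = add A"
    "module.smult (commutator_algebra A) = module.smult A"
    by (simp_all add: commutator_algebra_def)
  show ?thesis
  proof (unfold_locales, unfold s commutator_mult)
    fix x y z c assume x: "x \<in> carrier A" and y: "y \<in> carrier A"
    show "x \<otimes> y \<ominus> y \<otimes> x \<in> carrier A" using x y by auto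
    have d: "c \<odot> (u \<ominus> v) = c \<odot> u \<ominus> c \<odot> v" if "u \<in> carrier A" "v \<in> carrier A" for u v
      using that by (simp add: M.minus_eq smult_add_right smult_neg_1[symmetric] smult_smult)
    show "c \<odot> x \<otimes> y \<ominus> y \<otimes> (c \<odot> x) = c \<odot> (x \<otimes> y \<ominus> y \<otimes> x)"
      using x y by (simp add: d mult_smult_left mult_smult_right)
    show "x \<otimes> (c \<odot> y) \<ominus> c \<odot> y \<otimes> x = c \<odot> (x \<otimes> y \<ominus> y \<otimes> x)"
      using x y by (simp add: d mult_smult_left mult_smult_right)
    assume z: "z \<in> carrier A"
    show "(x \<oplus> y) \<otimes> z \<ominus> z \<otimes> (x \<oplus> y) = x \<otimes> z \<ominus> z \<otimes> x \<oplus> (y \<otimes> z \<ominus> z \<otimes> y)"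
      using x y z by (simp add: mult_add_left mult_add_right M.minus_eq M.minus_add M.a_ac)
    show "x \<otimes> (y \<oplus> z) \<ominus> (y \<oplus> z) \<otimes> x = x \<otimes> y \<ominus> y \<otimes> x \<oplus> (x \<otimes> z \<ominus> z \<otimes> x)"
      using x y z by (simp add: mult_add_left mult_add_right M.minus_eq M.minus_add M.a_ac)
  qed (auto simp: smult_add_left smult_add_right smult_smult)
qed

text \<open>A commutator is alternating by itself, so the Lie axioms amount to one multilinear
  identity of degree 3, which can then be handled operadically.\<close>

lemma lie_admissible_iff:
  "lie_admissible A \<longleftrightarrow> (\<forall>\<rho>. (\<forall>i. \<rho> i \<in> carrier A) \<longrightarrow> eval_poly A \<rho> commutator_jacobi = \<zero>)"
proof
  assume "lie_admissible A"
  then interpret C: lie_algebra "commutator_algebra A" by (simp add: lie_admissible_def)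
  show "\<forall>\<rho>. (\<forall>i. \<rho> i \<in> carrier A) \<longrightarrow> eval_poly A \<rho> commutator_jacobi = \<zero>"
    using C.jacobi unfolding commutator_mult
    by (simp add: eval_poly_commutator_jacobi) (simp add: commutator_algebra_def)
next
  assume J: "\<forall>\<rho>. (\<forall>i. \<rho> i \<in> carrier A) \<longrightarrow> eval_poly A \<rho> commutator_jacobi = \<zero>"
  have s: "carrier (commutator_algebra A) = carrier A" "add (commutator_algebra A) = add A"
    "ring.zero (commutator_algebra A) = ring.zero A"
    by (simp_all add: commutator_algebra_def)
  have "lie_algebra_axioms (commutator_algebra A)"
  proof (unfold_locales, unfold s commutator_mult)
    fix x y z assume x: "x \<in> carrier A"
    show "x \<otimes> x \<ominus> x \<otimes> x = \<zero>" using x by (simp add: M.minus_eq M.r_neg)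
    assume y: "y \<in> carrier A" and z: "z \<in> carrier A"
    define \<rho> where "\<rho> i = (if i = 0 then x else if i = 1 then y else z)" for i :: nat
    have "\<rho> i \<in> carrier A" for i using x y z by (simp add: \<rho>_def)
    then show "(((x \<otimes> y \<ominus> y \<otimes> x) \<otimes> z) \<ominus> (z \<otimes> (x \<otimes> y \<ominus> y \<otimes> x))) \<oplus>
      (((y \<otimes> z \<ominus> z \<otimes> y) \<otimes> x) \<ominus> (x \<otimes> (y \<otimes> z \<ominus> z \<otimes> y))) \<oplus>
      (((z \<otimes> x \<ominus> x \<otimes> z) \<otimes> y) \<ominus> (y \<otimes> (z \<otimes> x \<ominus> x \<otimes> z))) = \<zero>"
      using J eval_poly_commutator_jacobi[of \<rho>] by (simp add: \<rho>_def)
  qed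
  then show "lie_admissible A"
    using nonassoc_algebra_axioms nonassoc_algebra_commutator
    by (simp add: lie_admissible_def lie_algebra_def)
qed

end

section \<open>Quotients of free algebras\<close>

text \<open>In the algebras below, products of basis vectors are basis vectors, so a monomial can be
  evaluated in the magma of basis vectors before any linear algebra takes place.\<close>

primrec magma_eval :: "('a \<Rightarrow> 'a \<Rightarrow> 'a) \<Rightarrow> ('x \<Rightarrow> 'a) \<Rightarrow> 'x mterm \<Rightarrow> 'a" where
  "magma_eval m x (Var i) = x i"
| "magma_eval m x (App s t) = m (magma_eval m x s) (magma_eval m x t)"

text \<open>The algebra \<open>A\<close> is the image under \<open>q\<close> of the free vector space on \<open>Y\<close>, whose product is
  given on basis vectors by \<open>m\<close>. That \<open>q\<close> has a kernel which is an ideal is implicit in the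
  equations.\<close>

locale image_algebra =
  fixes A :: "('k::field, 'v) module" (structure)
    and q :: "('a \<Rightarrow>\<^sub>0 'k) \<Rightarrow> 'v" and Y :: "'a set" and m :: "'a \<Rightarrow> 'a \<Rightarrow> 'a"
  assumes basis_mult_closed: "x \<in> Y \<Longrightarrow> y \<in> Y \<Longrightarrow> m x y \<in> Y"
    and carrier_eq: "carrier A = q ` {f. Poly_Mapping.keys f \<subseteq> Y}"
    and q_zero: "\<zero> = q 0"
    and q_add: "Poly_Mapping.keys f \<subseteq> Y \<Longrightarrow> Poly_Mapping.keys g \<subseteq> Y \<Longrightarrow> q f \<oplus> q g = q (f + g)"
    and q_mult:
      "Poly_Mapping.keys f \<subseteq> Y \<Longrightarrow> Poly_Mapping.keys g \<subseteq> Y \<Longrightarrow> q f \<otimes> q g = q (bilin_ext m f g)"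
    and q_smult: "Poly_Mapping.keys f \<subseteq> Y \<Longrightarrow> c \<odot> q f = q (fscale c f)"
begin

abbreviation "W \<equiv> {f :: 'a \<Rightarrow>\<^sub>0 'k. Poly_Mapping.keys f \<subseteq> Y}"

lemma W_add: "f \<in> W \<Longrightarrow> g \<in> W \<Longrightarrow> f + g \<in> W"
  using subspace_keys by (rule fvs.subspace_add)

lemma W_fscale: "f \<in> W \<Longrightarrow> fscale c f \<in> W"
  using subspace_keys by (rule fvs.subspace_scale)

lemma W_bilin:
  assumes "f \<in> W" "g \<in> W"
  shows "bilin_ext m f g \<in> W"
proof -
  have "(\<lambda>(x, y). m x y) ` (Poly_Mapping.keys f \<times> Poly_Mapping.keys g) \<subseteq> Y"
    using assms by (auto intro!: basis_mult_closed)
  then show ?thesis using keys_bilin_ext[of m f g] by simp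
qed

lemma q_closed: "f \<in> W \<Longrightarrow> q f \<in> carrier A"
  by (auto simp: carrier_eq)

text \<open>Once elements are written as \<open>q f\<close>, every axiom becomes an equation between
  vectors of the free space, where it holds already.\<close>

lemma nonassoc: "nonassoc_algebra A"
proof -
  have cr: "cring (ring_of_type_algebra :: 'k ring)"
    by (rule cring_from_type_algebra)
  have c: "\<exists>f\<in>W. x = q f" if "x \<in> carrier A" for x
    using that by (auto simp: carrier_eq)
  have add: "q f \<oplus> q g = q (f + g)" if "f \<in> W" "g \<in> W" for f g using that q_add by simp
  have mul: "q f \<otimes> q g = q (bilin_ext m f g)" if "f \<in> W" "g \<in> W" for f g
    using that q_mult by simp
  have sm: "c \<odot> q f = q (fscale c f)" if "f \<in> W" for f c using that q_smult by simp
  have z: "0 \<in> W" by simp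
  have ag: "abelian_group A"
  proof (rule abelian_groupI)
    fix x y z assume x: "x \<in> carrier A" and y: "y \<in> carrier A"
    obtain f g where f: "f \<in> W" "x = q f" and g: "g \<in> W" "y = q g"
      using c x y by meson
    show "x \<oplus> y \<in> carrier A" "x \<oplus> y = y \<oplus> x" "\<zero> \<oplus> x = x"
      using f g z by (simp_all only: add W_add q_closed q_zero add.commute[of g] add_0)
    have "fscale (- 1) f + f = 0" by (rule poly_mapping_eqI) (simp add: lookup_add)
    then show "\<exists>y\<in>carrier A. y \<oplus> x = \<zero>"
      using f by (intro bexI[of _ "q (fscale (- 1) f)"]) (simp_all only: add W_fscale q_closed q_zero)
    assume "z \<in> carrier A"
    then obtain h where h: "h \<in> W" "z = q h" using c by meson
    show "x \<oplus> y \<oplus> z = x \<oplus> (y \<oplus> z)"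
      using f g h by (simp only: add W_add add.assoc)
  next
    show "\<zero> \<in> carrier A" unfolding q_zero using z by (rule q_closed)
  qed
  have "Module.module ring_of_type_algebra A"
  proof (intro moduleI cr ag, unfold type_ring_simps)
    fix a b x assume "x \<in> carrier A"
    then obtain f where f: "f \<in> W" "x = q f" using c by meson
    show "a \<odot> x \<in> carrier A" using f by (simp only: sm W_fscale q_closed)
    show "(a + b) \<odot> x = a \<odot> x \<oplus> b \<odot> x"
      using f by (simp only: sm W_fscale add fvs.scale_left_distrib)
    show "(a * b) \<odot> x = a \<odot> (b \<odot> x)" using f by (simp only: sm W_fscale fvs.scale_scale)
    show "1 \<odot> x = x" using f by (simp only: sm fvs.scale_one)
    fix y assume "y \<in> carrier A"
    then obtain g where g: "g \<in> W" "y = q g" using c by meson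
    show "a \<odot> (x \<oplus> y) = a \<odot> x \<oplus> a \<odot> y"
      using f g by (simp only: sm W_fscale W_add add fvs.scale_right_distrib)
  qed
  moreover have "nonassoc_algebra_axioms A"
  proof unfold_locales
    fix x y z c' assume "x \<in> carrier A" "y \<in> carrier A"
    then obtain f g where f: "f \<in> W" "x = q f" and g: "g \<in> W" "y = q g"
      using c by meson
    show "x \<otimes> y \<in> carrier A" using f g by (simp only: mul W_bilin q_closed)
    show "c' \<odot> x \<otimes> y = c' \<odot> (x \<otimes> y)" "x \<otimes> (c' \<odot> y) = c' \<odot> (x \<otimes> y)"
      using f g by (simp_all only: mul sm W_fscale W_bilin bilin_ext_fscale_left bilin_ext_fscale_right)
    assume "z \<in> carrier A"
    then obtain h where h: "h \<in> W" "z = q h" using c by meson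
    show "(x \<oplus> y) \<otimes> z = x \<otimes> z \<oplus> y \<otimes> z" "x \<otimes> (y \<oplus> z) = x \<otimes> y \<oplus> x \<otimes> z"
      using f g h
      by (simp_all only: mul add W_add W_bilin bilin_ext_add_left bilin_ext_add_right)
  qed
  ultimately show ?thesis by (simp add: nonassoc_algebra_def)
qed

sublocale nonassoc_algebra A by (rule nonassoc)

lemma q_basis_closed: "x \<in> Y \<Longrightarrow> q (basis x) \<in> carrier A"
  by (rule q_closed) simp

lemma magma_eval_closed: "(\<And>i. x i \<in> Y) \<Longrightarrow> magma_eval m x t \<in> Y"
  by (induction t) (auto intro: basis_mult_closed)

lemma eval_mterm_basis:
  assumes "\<And>i. x i \<in> Y"
  shows "eval_mterm A (\<lambda>i. q (basis (x i))) t = q (basis (magma_eval m x t))"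
  by (induction t) (simp_all add: q_mult magma_eval_closed assms)

lemma lincomb_q_basis:
  fixes y :: "'t \<Rightarrow> 'a"
  assumes "\<And>t. y t \<in> Y"
  shows "lincomb A (\<lambda>t. q (basis (y t))) f = q (lin_ext y f)"
proof (rule linear_into_eqI[where \<phi> = "lincomb A (\<lambda>t. q (basis (y t)))" and \<psi> = "\<lambda>f. q (lin_ext y f)"])
  have r: "range (\<lambda>t. q (basis (y t))) \<subseteq> carrier A"
    using assms by (auto intro: q_basis_closed)
  then show "linear_into A (lincomb A (\<lambda>t. q (basis (y t))))" by (rule linear_into_lincomb)
  have W: "Poly_Mapping.keys (lin_ext y f) \<subseteq> Y" for f :: "'t \<Rightarrow>\<^sub>0 'k"
    using keys_lin_ext[of y f] assms by auto
  show "linear_into A (\<lambda>f. q (lin_ext y f))"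
    using W by (simp add: linear_into_def q_closed q_add q_smult lin_ext_add lin_ext_fscale)
  show "lincomb A (\<lambda>t. q (basis (y t))) (basis t) = q (lin_ext y (basis t))" for t
    using assms by (simp add: q_basis_closed)
qed

lemma eval_poly_q_basis:
  assumes "\<And>i. x i \<in> Y"
  shows "eval_poly A (\<lambda>i. q (basis (x i))) f = q (lin_ext (magma_eval m x) f)"
proof -
  have "eval_poly A (\<lambda>i. q (basis (x i))) f = lincomb A (\<lambda>t. q (basis (magma_eval m x t))) f"
    unfolding eval_poly_lincomb
    by (rule arg_cong2[where f = "lincomb A"], rule ext) (simp_all only: eval_mterm_basis[OF assms])
  then show ?thesis by (simp add: lincomb_q_basis magma_eval_closed assms)
qed

lemma eval_poly_upd_linear:
  assumes f: "f \<in> Mag n" and i: "i < n" and \<rho>: "\<And>j. \<rho> j \<in> carrier A"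
    and x: "x \<in> carrier A" "y \<in> carrier A"
  shows "eval_poly A (\<rho>(i := c \<odot> x \<oplus> y)) f = c \<odot> eval_poly A (\<rho>(i := x)) f \<oplus> eval_poly A (\<rho>(i := y)) f"
proof -
  \<comment> \<open>The combination is indexed by two labels rather than by the elements themselves,
    so that \<open>x = y\<close> is not a special case.\<close>
  let ?v = "\<lambda>b. if b then x else y" let ?g = "Poly_Mapping.single True c + basis False"
  have v: "range ?v \<subseteq> carrier A" using x by auto
  have g: "lincomb A ?v ?g = c \<odot> x \<oplus> y"
    using x by (simp add: lincomb_add[OF v])
  have r: "range (eval_mterm A (\<rho>(i := z))) \<subseteq> carrier A" if "z \<in> carrier A" for z
    using \<rho> that by auto
  have t: "eval_mterm A (\<rho>(i := c \<odot> x \<oplus> y)) t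
      = c \<odot> eval_mterm A (\<rho>(i := x)) t \<oplus> eval_mterm A (\<rho>(i := y)) t"
    if "t \<in> Poly_Mapping.keys f" for t
  proof -
    have "range (\<lambda>b. eval_mterm A (\<rho>(i := ?v b)) t) \<subseteq> carrier A" using x \<rho> by auto
    then show ?thesis
      using eval_mterm_upd_lincomb[of t i \<rho> ?v ?g] keys_Mag[OF f that] i \<rho> v x
      by (simp add: g lincomb_add image_subset_iff)
  qed
  have "eval_poly A (\<rho>(i := c \<odot> x \<oplus> y)) f
      = lincomb A (\<lambda>t. c \<odot> eval_mterm A (\<rho>(i := x)) t \<oplus> eval_mterm A (\<rho>(i := y)) t) f"
    unfolding eval_poly_lincomb using x \<rho> t by (intro lincomb_cong) auto
  also have "\<dots> = c \<odot> eval_poly A (\<rho>(i := x)) f \<oplus> eval_poly A (\<rho>(i := y)) f"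
    using r[OF x(1)] r[OF x(2)]
    by (simp add: eval_poly_lincomb lincomb_plus lincomb_smult image_subset_iff)
  finally show ?thesis .
qed

text \<open>Multilinearity: the variables are specialised to basis vectors one after the other.\<close>

lemma eval_poly_zeroI:
  assumes f: "f \<in> Mag n"
    and zero: "\<And>x. (\<And>i. x i \<in> Y) \<Longrightarrow> eval_poly A (\<lambda>i. q (basis (x i))) f = \<zero>"
    and \<rho>: "\<And>i. \<rho> i \<in> carrier A" and Y: "Y \<noteq> {}"
  shows "eval_poly A \<rho> f = \<zero>"
proof -
  \<comment> \<open>Only the first \<open>k\<close> variables are still arbitrary; those from
    \<open>k\<close> to \<open>n - 1\<close> are already basis vectors.\<close>
  have "eval_poly A \<rho> f = \<zero>"
    if "\<And>i. \<rho> i \<in> carrier A" "\<And>i. k \<le> i \<Longrightarrow> i < n \<Longrightarrow> \<rho> i \<in> (\<lambda>x. q (basis x)) ` Y" "k \<le> n" for k \<rho>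
    using that
  proof (induction k arbitrary: \<rho>)
    case 0
    obtain y where y: "y \<in> Y" using Y by auto
    \<comment> \<open>Variables from \<open>n\<close> on do not occur in \<open>f\<close>, so their
      values may be replaced by an arbitrary basis vector \<open>y\<close>.\<close>
    have "\<exists>x\<in>Y. i < n \<longrightarrow> \<rho> i = q (basis x)" for i
      using 0 y by (cases "i < n") auto
    then obtain x where x: "\<And>i. x i \<in> Y" "\<And>i. i < n \<Longrightarrow> \<rho> i = q (basis (x i))" by metis
    have "eval_poly A \<rho> f = eval_poly A (\<lambda>i. q (basis (x i))) f"
      unfolding eval_poly_lincomb using keys_Mag[OF f] x
      by (intro lincomb_cong eval_mterm_closed q_basis_closed eval_mterm_cong) auto
    then show ?case using zero x by simp
  next
    case (Suc k)
    have "eval_poly A (\<rho>(k := q g)) f = \<zero>" if "Poly_Mapping.keys g \<subseteq> Y" for g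
      using that
    proof (induction g rule: poly_mapping_keys_induct)
      case zero
      have z: "\<zero> = 0 \<odot> \<zero> \<oplus> \<zero>" by simp
      have c: "eval_poly A (\<rho>(k := \<zero>)) f \<in> carrier A" using Suc.prems by auto
      have "eval_poly A (\<rho>(k := \<zero>)) f = 0 \<odot> eval_poly A (\<rho>(k := \<zero>)) f \<oplus> eval_poly A (\<rho>(k := \<zero>)) f"
        using eval_poly_upd_linear[OF f, of k \<rho> \<zero> \<zero> 1] Suc.prems c by simp
      \<comment> \<open>Linearity with coefficient 1 at zero plus zero says that the value equals
        its own double; cancelling shows that it is zero.\<close>
      moreover have "eval_poly A (\<rho>(k := \<zero>)) f \<oplus> eval_poly A (\<rho>(k := \<zero>)) f = eval_poly A (\<rho>(k := \<zero>)) f"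
        using eval_poly_upd_linear[OF f, of k \<rho> \<zero> \<zero> 1] Suc.prems c by simp
      ultimately show ?case
        using c M.add.l_cancel_one' by (metis q_zero)
    next
      case (add x c g)
      have e: "q (Poly_Mapping.single x c + g) = c \<odot> q (basis x) \<oplus> q g"
        using add by (simp add: q_smult q_add)
      \<comment> \<open>Variable \<open>k\<close> is now a basis vector as well, so the hypothesis
        for \<open>k\<close> applies.\<close>
      have "eval_poly A (\<rho>(k := q (basis x))) f = \<zero>"
        using Suc.prems add(1) by (intro Suc.IH) (auto simp: q_basis_closed)
      then show ?case
        unfolding e using add Suc.prems
        by (subst eval_poly_upd_linear[OF f]) (simp_all add: q_basis_closed q_closed del: fun_upd_apply)
    qed
    moreover obtain g where "Poly_Mapping.keys g \<subseteq> Y" "\<rho> k = q g"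
      using Suc.prems(1)[of k] by (auto simp: carrier_eq)
    ultimately show ?case by (metis fun_upd_triv)
  qed
  from this[of \<rho> n] show ?thesis using \<rho> by auto
qed

end

section \<open>Tensor products\<close>

definition tensor_mult ::
    "('k::field, 's) module \<Rightarrow> ('k, 'u) module \<Rightarrow> 's \<times> 'u \<Rightarrow> 's \<times> 'u \<Rightarrow> 's \<times> 'u" where
  "tensor_mult S U = (\<lambda>(a, u) (b, v). (a \<otimes>\<^bsub>S\<^esub> b, u \<otimes>\<^bsub>U\<^esub> v))"

locale tensor_product = S: nonassoc_algebra S + U: nonassoc_algebra U
  for S :: "('k::field, 's) module" and U :: "('k, 'u) module"
begin

abbreviation "N \<equiv> tensor_null S U"
abbreviation "Y \<equiv> carrier S \<times> carrier U"
abbreviation "tm \<equiv> tensor_mult S U"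

lemma null_add_left:
  "a \<in> carrier S \<Longrightarrow> b \<in> carrier S \<Longrightarrow> u \<in> carrier U \<Longrightarrow> basis (a \<oplus>\<^bsub>S\<^esub> b, u) - basis (a, u) - basis (b, u) \<in> N"
  unfolding tensor_null_def by (rule fvs.span_base) blast

lemma null_add_right:
  "a \<in> carrier S \<Longrightarrow> u \<in> carrier U \<Longrightarrow> v \<in> carrier U \<Longrightarrow> basis (a, u \<oplus>\<^bsub>U\<^esub> v) - basis (a, u) - basis (a, v) \<in> N"
  unfolding tensor_null_def by (rule fvs.span_base) blast

lemma null_smult_left:
  "a \<in> carrier S \<Longrightarrow> u \<in> carrier U \<Longrightarrow> basis (c \<odot>\<^bsub>S\<^esub> a, u) - Poly_Mapping.single (a, u) c \<in> N"
  unfolding tensor_null_def by (rule fvs.span_base) blast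

lemma null_smult_right:
  "a \<in> carrier S \<Longrightarrow> u \<in> carrier U \<Longrightarrow> basis (a, c \<odot>\<^bsub>U\<^esub> u) - Poly_Mapping.single (a, u) c \<in> N"
  unfolding tensor_null_def by (rule fvs.span_base) blast

lemma subspace_N: "fvs.subspace N"
  unfolding tensor_null_def by (rule fvs.subspace_span)

lemma N_induct [consumes 1, case_names subspace add_left add_right smult_left smult_right]:
  assumes "f \<in> N" "fvs.subspace V"
    and "\<And>a b u. a \<in> carrier S \<Longrightarrow> b \<in> carrier S \<Longrightarrow> u \<in> carrier U
      \<Longrightarrow> basis (a \<oplus>\<^bsub>S\<^esub> b, u) - basis (a, u) - basis (b, u) \<in> V"
    and "\<And>a u v. a \<in> carrier S \<Longrightarrow> u \<in> carrier U \<Longrightarrow> v \<in> carrier U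
      \<Longrightarrow> basis (a, u \<oplus>\<^bsub>U\<^esub> v) - basis (a, u) - basis (a, v) \<in> V"
    and "\<And>c a u. a \<in> carrier S \<Longrightarrow> u \<in> carrier U \<Longrightarrow> basis (c \<odot>\<^bsub>S\<^esub> a, u) - Poly_Mapping.single (a, u) c \<in> V"
    and "\<And>c a u. a \<in> carrier S \<Longrightarrow> u \<in> carrier U \<Longrightarrow> basis (a, c \<odot>\<^bsub>U\<^esub> u) - Poly_Mapping.single (a, u) c \<in> V"
  shows "f \<in> V"
proof -
  have "N \<subseteq> V"
    unfolding tensor_null_def using assms(2-) by (intro fvs.span_minimal) auto
  then show ?thesis using assms(1) by blast
qed

text \<open>Multiplication by a pure tensor maps each bilinearity relation to a relation of the same
  kind, by the distributive and scalar laws in the two factors.\<close>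

lemma null_mult_single:
  assumes "f \<in> N" "c \<in> carrier S" "w \<in> carrier U"
  shows "lin_ext (\<lambda>x. tm x (c, w)) f \<in> N" "lin_ext (tm (c, w)) f \<in> N"
proof -
  have "f \<in> {f. lin_ext (\<lambda>x. tm x (c, w)) f \<in> N}"
    using assms(1)
  proof (induction rule: N_induct)
    case subspace
    show ?case using subspace_N
      by (simp add: fvs.subspace_def lin_ext_add lin_ext_fscale)
  qed (use assms in \<open>simp_all add: lin_ext_diff tensor_mult_def S.mult_add_left U.mult_add_left S.mult_smult_left
      U.mult_smult_left null_add_left null_add_right null_smult_left null_smult_right\<close>)
  then show "lin_ext (\<lambda>x. tm x (c, w)) f \<in> N" by simp
  have "f \<in> {f. lin_ext (tm (c, w)) f \<in> N}"
    using assms(1)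
  proof (induction rule: N_induct)
    case subspace
    show ?case using subspace_N
      by (simp add: fvs.subspace_def lin_ext_add lin_ext_fscale)
  qed (use assms in \<open>simp_all add: lin_ext_diff tensor_mult_def S.mult_add_right U.mult_add_right S.mult_smult_right
      U.mult_smult_right null_add_left null_add_right null_smult_left null_smult_right\<close>)
  then show "lin_ext (tm (c, w)) f \<in> N" by simp
qed

lemma null_mult:
  assumes "f \<in> N" "Poly_Mapping.keys g \<subseteq> Y"
  shows "bilin_ext tm f g \<in> N" "bilin_ext tm g f \<in> N"
proof -
  have "bilin_ext tm f g \<in> N \<and> bilin_ext tm g f \<in> N"
    using assms(2)
  proof (induction g rule: poly_mapping_keys_induct)
    case zero
    show ?case using subspace_N by (simp add: fvs.subspace_0)
  next
    case (add x c g)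
    then show ?case
      using assms(1) subspace_N
      by (auto simp: bilin_ext_add_left bilin_ext_add_right bilin_ext_single_left bilin_ext_single_right
          intro!: fvs.subspace_add fvs.subspace_scale null_mult_single)
  qed
  then show "bilin_ext tm f g \<in> N" "bilin_ext tm g f \<in> N" by auto
qed

abbreviation "q \<equiv> tensor_coset S U"

lemma coset_self: "f \<in> q f"
  using fvs.subspace_0[OF subspace_N] by (force simp: tensor_coset_def)

lemma coset_mem: "g \<in> q f \<longleftrightarrow> g - f \<in> N"
  by (force simp: tensor_coset_def image_iff)

lemma coset_eq: "q f = q g \<longleftrightarrow> f - g \<in> N"
proof
  assume "q f = q g"
  then show "f - g \<in> N" using coset_self[of f] by (simp add: coset_mem)
next
  assume *: "f - g \<in> N"
  have "h - f \<in> N \<longleftrightarrow> h - g \<in> N" for h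
    using fvs.subspace_add[OF subspace_N _ *, of "h - f"] fvs.subspace_diff[OF subspace_N _ *, of "h - g"]
    by auto
  then show "q f = q g" by (auto simp: coset_mem)
qed

text \<open>Operations of \<open>tensor_algebra\<close> are unions over representatives. If all
  results lie in one coset, the union over the nonempty set of representatives is that
  coset.\<close>

lemma coset_UN:
  assumes "\<And>f' . f' \<in> q f \<Longrightarrow> \<phi> f' - \<phi> f \<in> N"
  shows "(\<Union>f'\<in>q f. q (\<phi> f')) = q (\<phi> f)"
proof -
  have "q (\<phi> f') = q (\<phi> f)" if "f' \<in> q f" for f'
    using assms that by (simp add: coset_eq)
  then have "(\<lambda>f'. q (\<phi> f')) ` q f = {q (\<phi> f)}" using coset_self[of f] by blast
  then show ?thesis by simp
qed

lemma coset_UN2: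
  assumes "\<And>f' g'. f' - f \<in> N \<Longrightarrow> g' - g \<in> N \<Longrightarrow> \<phi> f' g' - \<phi> f g \<in> N"
  shows "(\<Union>f'\<in>q f. \<Union>g'\<in>q g. q (\<phi> f' g')) = q (\<phi> f g)"
proof -
  have "q (\<phi> f' g') = q (\<phi> f g)" if "f' \<in> q f" "g' \<in> q g" for f' g'
    using assms that by (simp add: coset_eq coset_mem)
  then show ?thesis using coset_self[of f] coset_self[of g] by blast
qed

text \<open>Consequently every representative of the coset of a vector supported on \<open>Y\<close>
  is itself supported there, as \<open>null_mult\<close> requires.\<close>

lemma keys_N: "f \<in> N \<Longrightarrow> Poly_Mapping.keys f \<subseteq> Y"
proof -
  assume "f \<in> N"
  then have "f \<in> {f. Poly_Mapping.keys f \<subseteq> Y}"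
  proof (induction rule: N_induct)
    case subspace
    show ?case by (rule subspace_keys)
  qed (use subspace_keys[of Y] in \<open>intro fvs.subspace_diff; simp\<close>)+
  then show ?thesis by simp
qed

lemma image_algebra_tensor: "image_algebra (tensor_algebra S U) q Y tm"
proof unfold_locales
  show "tm x y \<in> Y" if "x \<in> Y" "y \<in> Y" for x y
    using that by (auto simp: tensor_mult_def)
  show "carrier (tensor_algebra S U) = q ` {f. Poly_Mapping.keys f \<subseteq> Y}"
    by (simp add: tensor_algebra_def tensor_free_def)
  show "\<zero>\<^bsub>tensor_algebra S U\<^esub> = q 0" by (simp add: tensor_algebra_def)
  fix f g :: "'s \<times> 'u \<Rightarrow>\<^sub>0 'k" and c assume f: "Poly_Mapping.keys f \<subseteq> Y"
  have "fscale c f' - fscale c f \<in> N" if "f' \<in> q f" for f'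
    using that fvs.subspace_scale[OF subspace_N, of "f' - f" c]
    by (simp add: coset_mem fvs.scale_right_diff_distrib)
  then show "c \<odot>\<^bsub>tensor_algebra S U\<^esub> q f = q (fscale c f)"
    by (simp add: tensor_algebra_def coset_UN)
  have "(f' + g') - (f + g) \<in> N" if "f' - f \<in> N" "g' - g \<in> N" for f' g'
    using fvs.subspace_add[OF subspace_N that] by (simp add: algebra_simps)
  then show "q f \<oplus>\<^bsub>tensor_algebra S U\<^esub> q g = q (f + g)"
    by (simp add: tensor_algebra_def coset_UN2)
  assume g: "Poly_Mapping.keys g \<subseteq> Y"
  have "bilin_ext tm f' g' - bilin_ext tm f g \<in> N" if *: "f' - f \<in> N" "g' - g \<in> N" for f' g'
  proof -
    have "Poly_Mapping.keys f' \<subseteq> Y"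
      using fvs.subspace_add[OF subspace_keys[of Y], of "f' - f" f] keys_N[OF *(1)] f by simp
    \<comment> \<open>The usual splitting of a difference of products; its second summand needs the
      support of \<open>f'\<close>.\<close>
    then have "bilin_ext tm (f' - f) g + bilin_ext tm f' (g' - g) \<in> N"
      using null_mult * g by (intro fvs.subspace_add[OF subspace_N]) auto
    then show ?thesis by (simp add: bilin_ext_diff_left bilin_ext_diff_right)
  qed
  then show "q f \<otimes>\<^bsub>tensor_algebra S U\<^esub> q g = q (bilin_ext tm f g)"
    unfolding tensor_mult_def by (simp add: tensor_algebra_def coset_UN2)
qed

sublocale T: image_algebra "tensor_algebra S U" q Y tm
  by (rule image_algebra_tensor)

lemma magma_eval_tensor:
  "magma_eval tm (\<lambda>i. (a i, u i)) t = (eval_mterm S a t, eval_mterm U u t)"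
  by (induction t) (simp_all add: tensor_mult_def)

text \<open>Tensoring with a fixed \<open>p\<close> is linear in the right factor. This pulls out
  the common value in \<open>S\<close> of all monomials of the Jacobi polynomial.\<close>

lemma coset_lin_ext_pair:
  assumes "p \<in> carrier S" "range w \<subseteq> carrier U"
  shows "q (lin_ext (\<lambda>t. (p, w t)) f) = q (basis (p, lincomb U w f))"
proof -
  have w: "w t \<in> carrier U" for t using assms by auto
  have lin: "linear_into (tensor_algebra S U) (\<lambda>f. q (basis (p, lincomb U w f)))"
    unfolding linear_into_def
  proof (intro conjI allI)
    fix f g and c :: 'k
    have cl: "lincomb U w f \<in> carrier U" for f by (rule U.lincomb_closed[OF assms(2)])
    show "q (basis (p, lincomb U w f)) \<in> carrier (tensor_algebra S U)"
      using cl assms by (intro T.q_basis_closed) auto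
    show "q (basis (p, lincomb U w (f + g)))
      = q (basis (p, lincomb U w f)) \<oplus>\<^bsub>tensor_algebra S U\<^esub> q (basis (p, lincomb U w g))"
      using cl assms null_add_right[OF assms(1) cl cl]
      by (simp add: T.q_add coset_eq U.lincomb_add[OF assms(2)] algebra_simps)
    show "q (basis (p, lincomb U w (fscale c f))) = c \<odot>\<^bsub>tensor_algebra S U\<^esub> q (basis (p, lincomb U w f))"
      using cl assms null_smult_right[OF assms(1) cl]
      by (simp add: T.q_smult coset_eq U.lincomb_fscale[OF assms(2)])
  qed
  have "lincomb (tensor_algebra S U) (\<lambda>t. q (basis (p, w t))) f = q (basis (p, lincomb U w f))"
    using lin
  proof (rule T.linear_into_eqI[where \<psi> = "\<lambda>f. q (basis (p, lincomb U w f))" and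
        \<phi> = "lincomb (tensor_algebra S U) (\<lambda>t. q (basis (p, w t)))", rotated])
    have r: "q (basis (p, w t)) \<in> carrier (tensor_algebra S U)" for t
      using assms w by (intro T.q_basis_closed) auto
    then show "linear_into (tensor_algebra S U) (lincomb (tensor_algebra S U) (\<lambda>t. q (basis (p, w t))))"
      by (intro T.linear_into_lincomb) auto
    show "lincomb (tensor_algebra S U) (\<lambda>t. q (basis (p, w t))) (basis t)
        = q (basis (p, lincomb U w (basis t)))" for t
      using r w by simp
  qed
  then show ?thesis using assms w by (simp add: T.lincomb_q_basis)
qed

lemma coset_basis_zero: "p \<in> carrier S \<Longrightarrow> q (basis (p, \<zero>\<^bsub>U\<^esub>)) = q 0"
  using coset_lin_ext_pair[of p "\<lambda>_. \<zero>\<^bsub>U\<^esub>" "0 :: nat \<Rightarrow>\<^sub>0 'k"] by simp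

end

section \<open>Quotients carried by a given type\<close>

text \<open>A quotient can live in any type that accommodates its cosets: \<open>q\<close> is meant
  to take equal values exactly on equal cosets, and the operations go through chosen preimages. This
  builds algebras inside the prescribed type \<open>'v\<close>.\<close>

definition quotient_algebra ::
    "(('a \<Rightarrow>\<^sub>0 'k::field) \<Rightarrow> 'v) \<Rightarrow> ('a \<Rightarrow> 'a \<Rightarrow> 'a) \<Rightarrow> ('k, 'v) module" where
  "quotient_algebra q m =
     \<lparr>carrier = range q,
      monoid.mult = (\<lambda>x y. q (bilin_ext m (inv_into UNIV q x) (inv_into UNIV q y))),
      one = undefined,
      ring.zero = q 0,
      add = (\<lambda>x y. q (inv_into UNIV q x + inv_into UNIV q y)),
      module.smult = (\<lambda>c x. q (fscale c (inv_into UNIV q x)))\<rparr>"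

text \<open>A chosen preimage \<open>r f\<close> differs from \<open>f\<close> by an element of the
  ideal \<open>N\<close>, so the choice does not affect the class of a result.\<close>

lemma image_algebra_quotient:
  assumes N: "fvs.subspace N" and q: "\<And>f g. q f = q g \<longleftrightarrow> f - g \<in> N"
    and ideal: "\<And>f g. f \<in> N \<Longrightarrow> bilin_ext m f g \<in> N" "\<And>f g. f \<in> N \<Longrightarrow> bilin_ext m g f \<in> N"
  shows "image_algebra (quotient_algebra q m) q UNIV m"
proof -
  define r where "r f = inv_into UNIV q (q f)" for f
  have r: "r f - f \<in> N" for f
    unfolding r_def q[symmetric] by (simp add: f_inv_into_f)
  have "r f + r g - (f + g) \<in> N" for f g
    using fvs.subspace_add[OF N r[of f] r[of g]] by (simp add: algebra_simps)
  moreover have "bilin_ext m (r f) (r g) - bilin_ext m f g \<in> N" for f g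
    using fvs.subspace_add[OF N ideal(1)[OF r[of f], of "r g"] ideal(2)[OF r[of g], of f]]
    by (simp add: bilin_ext_diff_left bilin_ext_diff_right)
  moreover have "fscale c (r f) - fscale c f \<in> N" for c f
    using fvs.subspace_scale[OF N r[of f], of c] by (simp add: fvs.scale_right_diff_distrib)
  ultimately show ?thesis
    by unfold_locales (simp_all add: quotient_algebra_def r_def[symmetric] q)
qed

section \<open>Lie-admissibility of tensor products\<close>

text \<open>Bounding the support suffices: all twelve monomials take the same value in
  \<open>S\<close>, so their signs matter only in the factor \<open>U\<close>.\<close>

lemma keys_commutator_jacobi:
  "Poly_Mapping.keys (commutator_jacobi :: nat mterm \<Rightarrow>\<^sub>0 'k::field) \<subseteq>
    (let m = (\<lambda>i j k. {App (App (Var i) (Var j)) (Var k), App (Var i) (App (Var j) (Var k))})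
     in m 0 1 2 \<union> m 0 2 1 \<union> m 1 0 2 \<union> m 1 2 0 \<union> m 2 0 1 \<union> m 2 1 0)"
  (is "_ \<subseteq> ?M")
proof -
  have s: "(commutator_jacobi :: nat mterm \<Rightarrow>\<^sub>0 'k) \<in> {f. Poly_Mapping.keys f \<subseteq> ?M}"
    unfolding commutator_jacobi_def commutator_def Let_def bilin_ext_diff_left bilin_ext_diff_right
      bilin_ext_single
    by (intro fvs.subspace_add[OF subspace_keys] fvs.subspace_diff[OF subspace_keys]) simp_all
  then show ?thesis by blast
qed

lemma commutator_jacobi_in_Mag: "commutator_jacobi \<in> Mag 3"
proof -
  have "{..<3::nat} = {0, 1, 2}" by auto
  then show ?thesis
    unfolding Mag_def using keys_commutator_jacobi by (fastforce simp: Let_def)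
qed

lemma diCom_I_relations_in_Mag: "diCom_I_relations \<subseteq> Mag 3"
proof -
  have n: "{..<3::nat} = {0, 1, 2}" by auto
  show ?thesis
    unfolding diCom_I_relations_def identity_def Let_def
    by (auto intro!: fvs.subspace_diff[OF subspace_Mag] single_in_Mag simp: n)
qed

lemma operad_algebra_LieAdm_iff:
  "operad_algebra LieAdm U \<longleftrightarrow> lie_admissible U" if "nonassoc_algebra U"
proof -
  interpret nonassoc_algebra U by (rule that)
  show ?thesis
    unfolding LieAdm_def lie_admissible_iff
    by (subst operad_algebra_quadratic_iff) (auto simp: commutator_jacobi_in_Mag)
qed

text \<open>Associativity moves all brackets to the right. Exchanging the last two factors and
  exchanging the outer two then generate all permutations of three factors.\<close>

lemma diCom_I_monomials:
  assumes S: "operad_algebra diCom_I S" and a: "\<And>i. a i \<in> carrier S"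
    and t: "t \<in> Poly_Mapping.keys (commutator_jacobi :: nat mterm \<Rightarrow>\<^sub>0 'k::field)"
  shows "eval_mterm (S :: ('k, 's) module) a t = a 0 \<otimes>\<^bsub>S\<^esub> (a 1 \<otimes>\<^bsub>S\<^esub> a 2)"
proof -
  interpret nonassoc_algebra S using S by (simp add: operad_algebra_def)
  have rel: "\<forall>f\<in>diCom_I_relations. \<forall>\<rho>. (\<forall>i. \<rho> i \<in> carrier S) \<longrightarrow> eval_poly S \<rho> f = \<zero>\<^bsub>S\<^esub>"
    using S unfolding diCom_I_def by (simp add: operad_algebra_quadratic_iff diCom_I_relations_in_Mag)
  have eq: "eval_mterm S \<rho> s = eval_mterm S \<rho> t"
    if "identity s t \<in> (diCom_I_relations :: (nat mterm \<Rightarrow>\<^sub>0 'k) set)" "\<And>i. \<rho> i \<in> carrier S"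
    for s t and \<rho> :: "nat \<Rightarrow> 's"
  proof -
    have "eval_poly S \<rho> (basis s - basis t) = \<zero>\<^bsub>S\<^esub>" using rel that by (auto simp: identity_def)
    then show ?thesis
      using that(2) M.minus_equality[of "eval_mterm S \<rho> s" "\<ominus>\<^bsub>S\<^esub> eval_mterm S \<rho> t"]
      by (simp add: eval_poly_diff eval_poly_basis M.minus_eq)
  qed
  \<comment> \<open>These are the first, the third and the last defining relation, with the right
    product rewritten by the left one. The reversal of the factors is the identity special to
    initial dialgebras.\<close>
  have laws: "x \<otimes>\<^bsub>S\<^esub> (y \<otimes>\<^bsub>S\<^esub> z) = x \<otimes>\<^bsub>S\<^esub> (z \<otimes>\<^bsub>S\<^esub> y)"
    "(x \<otimes>\<^bsub>S\<^esub> y) \<otimes>\<^bsub>S\<^esub> z = x \<otimes>\<^bsub>S\<^esub> (y \<otimes>\<^bsub>S\<^esub> z)"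
    "z \<otimes>\<^bsub>S\<^esub> (y \<otimes>\<^bsub>S\<^esub> x) = x \<otimes>\<^bsub>S\<^esub> (y \<otimes>\<^bsub>S\<^esub> z)"
    if "x \<in> carrier S" "y \<in> carrier S" "z \<in> carrier S" for x y z
  proof -
    define \<rho> where "\<rho> i = (if i = 0 then x else if i = 1 then y else z)" for i :: nat
    have \<rho>: "\<rho> i \<in> carrier S" for i using that by (simp add: \<rho>_def)
    have v: "\<rho> 0 = x" "\<rho> 1 = y" "\<rho> 2 = z" by (simp_all add: \<rho>_def)
    have "eval_mterm S \<rho> s = eval_mterm S \<rho> t"
      if "identity s t \<in> (diCom_I_relations :: (nat mterm \<Rightarrow>\<^sub>0 'k) set)" for s t
      using that \<rho> by (rule eq)
    note e = this[unfolded diCom_I_relations_def Let_def]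
    show "x \<otimes>\<^bsub>S\<^esub> (y \<otimes>\<^bsub>S\<^esub> z) = x \<otimes>\<^bsub>S\<^esub> (z \<otimes>\<^bsub>S\<^esub> y)"
      using e[of "Var 0 \<stileturn> (Var 1 \<stileturn> Var 2)" "Var 0 \<stileturn> (Var 2 \<stileturn> Var 1)"]
      unfolding eval_mterm.simps v by blast
    show "(x \<otimes>\<^bsub>S\<^esub> y) \<otimes>\<^bsub>S\<^esub> z = x \<otimes>\<^bsub>S\<^esub> (y \<otimes>\<^bsub>S\<^esub> z)"
      using e[of "(Var 0 \<stileturn> Var 1) \<stileturn> Var 2" "Var 0 \<stileturn> (Var 1 \<stileturn> Var 2)"]
      unfolding eval_mterm.simps v by blast
    show "z \<otimes>\<^bsub>S\<^esub> (y \<otimes>\<^bsub>S\<^esub> x) = x \<otimes>\<^bsub>S\<^esub> (y \<otimes>\<^bsub>S\<^esub> z)"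
      using e[of "Var 2 \<stileturn> (Var 1 \<stileturn> Var 0)" "Var 0 \<stileturn> (Var 1 \<stileturn> Var 2)"]
      unfolding eval_mterm.simps v by blast
  qed
  let ?p = "\<lambda>i j k. a i \<otimes>\<^bsub>S\<^esub> (a j \<otimes>\<^bsub>S\<^esub> a k)"
  have swap: "?p i j k = ?p i k j" "?p k j i = ?p i j k" for i j k
    using laws a by auto
  have "?p 0 2 1 = ?p 0 1 2" "?p 1 0 2 = ?p 0 1 2" "?p 1 2 0 = ?p 0 1 2"
    "?p 2 0 1 = ?p 0 1 2" "?p 2 1 0 = ?p 0 1 2"
    using swap by metis+
  moreover have "a i \<otimes>\<^bsub>S\<^esub> a j \<otimes>\<^bsub>S\<^esub> a k = ?p i j k" for i j k using laws a by blast
  ultimately show ?thesis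
    using subsetD[OF keys_commutator_jacobi t] unfolding Let_def by auto
qed

lemma lie_admissible_tensor:
  fixes S :: "('k::field, 's) module" and U :: "('k, 'u) module"
  assumes S: "operad_algebra diCom_I S" and U: "lie_admissible U"
  shows "lie_admissible (tensor_algebra S U)"
proof -
  interpret tensor_product S U
    using S U by (simp add: tensor_product_def operad_algebra_def lie_admissible_def)
  have "eval_poly (tensor_algebra S U) (\<lambda>i. q (basis (x i))) commutator_jacobi = \<zero>\<^bsub>tensor_algebra S U\<^esub>"
    if x: "\<And>i. x i \<in> Y" for x
  proof -
    define a where "a i = fst (x i)" for i
    define u where "u i = snd (x i)" for i
    have xau: "x = (\<lambda>i. (a i, u i))" and a: "a i \<in> carrier S" and u: "u i \<in> carrier U" for i
      using x by (auto simp: a_def u_def mem_Times_iff)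
    let ?p = "a 0 \<otimes>\<^bsub>S\<^esub> (a 1 \<otimes>\<^bsub>S\<^esub> a 2)"
    have "eval_poly (tensor_algebra S U) (\<lambda>i. q (basis (x i))) commutator_jacobi
        = q (lin_ext (magma_eval tm x) commutator_jacobi)"
      using x by (rule T.eval_poly_q_basis)
    also have "lin_ext (magma_eval tm x) (commutator_jacobi :: nat mterm \<Rightarrow>\<^sub>0 'k)
        = lin_ext (\<lambda>t. (?p, eval_mterm U u t)) commutator_jacobi"
      unfolding xau magma_eval_tensor using diCom_I_monomials[OF S, of a] a by (intro lin_ext_cong) simp
    also have "q \<dots> = q (basis (?p, eval_poly U u commutator_jacobi))"
      unfolding eval_poly_lincomb using a u by (intro coset_lin_ext_pair) auto
    also have "eval_poly U u commutator_jacobi = \<zero>\<^bsub>U\<^esub>"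
      using U u by (simp add: U.lie_admissible_iff)
    also have "q (basis (?p, \<zero>\<^bsub>U\<^esub>)) = q 0" using a by (intro coset_basis_zero) auto
    finally show ?thesis by (simp add: T.q_zero)
  qed
  moreover have "Y \<noteq> {}" using S.M.zero_closed U.M.zero_closed by blast
  \<comment> \<open>The computation above concerned pure tensors; multilinearity of the Jacobi
    polynomial extends it to all elements.\<close>
  ultimately show ?thesis
    unfolding T.lie_admissible_iff
    by (intro allI impI) (rule T.eval_poly_zeroI[OF commutator_jacobi_in_Mag], blast+)
qed

text \<open>The field as the free vector space on one idempotent \<open>()\<close>, with its scalars
  stored in \<open>'v\<close> through \<open>h\<close>.\<close>

definition ground_field :: "('k::field \<Rightarrow> 'v) \<Rightarrow> ('k, 'v) module" where
  "ground_field h = quotient_algebra (\<lambda>f. h (Poly_Mapping.lookup f ())) (\<lambda>_ _. ())"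

lemma image_algebra_ground_field:
  assumes "inj h"
  shows "image_algebra (ground_field h) (\<lambda>f. h (Poly_Mapping.lookup f ())) UNIV (\<lambda>_ _. ())"
  unfolding ground_field_def
proof (rule image_algebra_quotient[where N = "{0}"])
  fix f g :: "unit \<Rightarrow>\<^sub>0 'a"
  show "h (Poly_Mapping.lookup f ()) = h (Poly_Mapping.lookup g ()) \<longleftrightarrow> f - g \<in> {0}"
    using assms by (auto simp: inj_eq intro: poly_mapping_eqI)
qed auto

text \<open>At the idempotent basis vector every monomial evaluates to that vector, so a difference
  of two monomials vanishes.\<close>

lemma operad_algebra_ground_field:
  assumes "inj h"
  shows "operad_algebra diCom_I (ground_field h)"
proof -
  interpret K: image_algebra "ground_field h" "\<lambda>f. h (Poly_Mapping.lookup f ())" UNIV "\<lambda>_ _. ()"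
    using assms by (rule image_algebra_ground_field)
  have "eval_poly (ground_field h) \<rho> f = \<zero>\<^bsub>ground_field h\<^esub>"
    if f: "f \<in> diCom_I_relations" and \<rho>: "\<forall>i. \<rho> i \<in> carrier (ground_field h)" for f \<rho>
  proof (rule K.eval_poly_zeroI)
    show "f \<in> Mag 3" using f diCom_I_relations_in_Mag by blast
    obtain s t where st: "f = identity s t" using f by (auto simp: diCom_I_relations_def Let_def)
    show "eval_poly (ground_field h) (\<lambda>i. h (Poly_Mapping.lookup (basis (x i)) ())) f = \<zero>\<^bsub>ground_field h\<^esub>"
      for x :: "nat \<Rightarrow> unit"
      by (simp only: K.eval_poly_q_basis[of x f, OF UNIV_I] K.q_zero)
        (simp add: st identity_def lin_ext_diff)
  qed (use \<rho> in auto)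
  then show ?thesis
    unfolding diCom_I_def by (subst K.operad_algebra_quadratic_iff[OF diCom_I_relations_in_Mag]) blast
qed

text \<open>Of the isomorphism between \<open>K \<otimes> U\<close> and \<open>U\<close> only one
  direction is used: \<open>\<phi>\<close> multiplies \<open>u\<close> by the scalar
  \<open>a\<close>, kills the bilinearity relations, and so detects whether the tensor of the unit
  with a Jacobi value is zero.\<close>

lemma lie_admissible_of_tensor_ground_field:
  fixes h :: "'k::field \<Rightarrow> 'v" and U :: "('k, 'v) module"
  assumes h: "inj h" and U: "nonassoc_algebra U"
    and T: "lie_admissible (tensor_algebra (ground_field h) U)"
  shows "lie_admissible U"
proof -
  define qk :: "(unit \<Rightarrow>\<^sub>0 'k) \<Rightarrow> 'v" where "qk f = h (Poly_Mapping.lookup f ())" for f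
  interpret K: image_algebra "ground_field h" qk UNIV "\<lambda>_ _. ()"
    unfolding qk_def using h by (rule image_algebra_ground_field)
  interpret tensor_product "ground_field h" U
    using U by (simp add: tensor_product_def K.nonassoc)
  define \<kappa> where "\<kappa> = inv_into UNIV h"
  have \<kappa>: "\<kappa> (qk f) = Poly_Mapping.lookup f ()" for f by (simp add: \<kappa>_def qk_def h)
  define e where "e = qk (basis ())"
  have e: "e \<in> carrier (ground_field h)" "\<kappa> e = 1"
    unfolding e_def by (rule K.q_basis_closed) (simp_all add: \<kappa>)
  \<comment> \<open>The laws of \<open>lincomb\<close> ask for all indexed vectors to lie in the
    carrier, whence the value zero elsewhere.\<close>
  define \<phi> where "\<phi> = lincomb U (\<lambda>(a, u). if u \<in> carrier U then \<kappa> a \<odot>\<^bsub>U\<^esub> u else \<zero>\<^bsub>U\<^esub>)"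
  have r: "range (\<lambda>(a, u). if u \<in> carrier U then \<kappa> a \<odot>\<^bsub>U\<^esub> u else \<zero>\<^bsub>U\<^esub>) \<subseteq> carrier U" by auto
  have \<phi>1: "\<phi> (Poly_Mapping.single (a, u) c) = (c * \<kappa> a) \<odot>\<^bsub>U\<^esub> u" if "u \<in> carrier U" for a u c
    using that by (simp add: \<phi>_def U.smult_smult)
  have cancel: "x \<oplus>\<^bsub>U\<^esub> y \<ominus>\<^bsub>U\<^esub> x \<ominus>\<^bsub>U\<^esub> y = \<zero>\<^bsub>U\<^esub>" if "x \<in> carrier U" "y \<in> carrier U" for x y
  proof -
    have "x \<oplus>\<^bsub>U\<^esub> y \<ominus>\<^bsub>U\<^esub> x \<ominus>\<^bsub>U\<^esub> y = (x \<ominus>\<^bsub>U\<^esub> x) \<oplus>\<^bsub>U\<^esub> (y \<ominus>\<^bsub>U\<^esub> y)"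
      using that by (simp add: U.M.minus_eq U.M.a_ac)
    then show ?thesis using that by (simp add: U.M.minus_eq U.M.r_neg)
  qed
  have \<phi>N: "\<phi> f = \<zero>\<^bsub>U\<^esub>" if "f \<in> N" for f
  proof -
    have "f \<in> {f. \<phi> f = \<zero>\<^bsub>U\<^esub>}"
      using that
    proof (induction rule: N_induct)
      case subspace
      show ?case
        by (auto simp: fvs.subspace_def \<phi>_def U.lincomb_add[OF r] U.lincomb_fscale[OF r])
    next
      case (add_left a b u)
      then obtain f g where "a = qk f" "b = qk g" by (auto simp: K.carrier_eq)
      then have "\<kappa> (a \<oplus>\<^bsub>ground_field h\<^esub> b) = \<kappa> a + \<kappa> b" by (simp add: K.q_add \<kappa> lookup_add)
      then show ?case using add_left
        by (simp add: \<phi>_def U.lincomb_diff[OF r])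
           (simp add: \<phi>_def[symmetric] \<phi>1 U.smult_add_left cancel)
    next
      case (add_right a u v)
      then show ?case
        by (simp add: \<phi>_def U.lincomb_diff[OF r])
           (simp add: \<phi>_def[symmetric] \<phi>1 U.smult_add_right cancel)
    next
      case (smult_left c a u)
      then obtain f where "a = qk f" by (auto simp: K.carrier_eq)
      then have "\<kappa> (c \<odot>\<^bsub>ground_field h\<^esub> a) = c * \<kappa> a" by (simp add: K.q_smult \<kappa>)
      then show ?case using smult_left
        by (simp add: \<phi>_def U.lincomb_diff[OF r])
           (simp add: \<phi>_def[symmetric] \<phi>1 U.smult_smult U.M.minus_eq U.M.r_neg)
    next
      case (smult_right c a u)
      then show ?case
        by (simp add: \<phi>_def U.lincomb_diff[OF r])
           (simp add: \<phi>_def[symmetric] \<phi>1 U.smult_smult U.M.minus_eq U.M.r_neg mult.commute)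
    qed
    then show ?thesis by simp
  qed
  show ?thesis
    unfolding U.lie_admissible_iff
  proof (intro allI impI)
    fix u :: "nat \<Rightarrow> 'v" assume u: "\<forall>i. u i \<in> carrier U"
    let ?T = "tensor_algebra (ground_field h) U"
    define x where "x = eval_poly U u commutator_jacobi"
    have x: "x \<in> carrier U" using u by (simp add: x_def)
    \<comment> \<open>The unit \<open>e\<close> is idempotent, so it survives as the left factor of
      every monomial.\<close>
    have m: "magma_eval tm (\<lambda>i. (e, u i)) t = (e, eval_mterm U u t)" for t
      using K.eval_mterm_basis[of "\<lambda>_. ()" t] by (simp add: magma_eval_tensor e_def)
    have eu: "(e, u i) \<in> Y" for i using e u by simp
    have "q 0 = eval_poly ?T (\<lambda>i. q (basis (e, u i))) commutator_jacobi"
      using T T.q_basis_closed[OF eu] by (simp add: T.lie_admissible_iff T.q_zero)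
    also have "\<dots> = q (lin_ext (magma_eval tm (\<lambda>i. (e, u i))) commutator_jacobi)"
      using eu by (rule T.eval_poly_q_basis)
    also have "\<dots> = q (basis (e, x))"
      unfolding m x_def eval_poly_lincomb using e u by (intro coset_lin_ext_pair) auto
    finally have "basis (e, x) \<in> N" by (metis coset_eq diff_zero)
    then show "eval_poly U u commutator_jacobi = \<zero>\<^bsub>U\<^esub>"
      using \<phi>N[of "basis (e, x)"] x e by (simp add: \<phi>1 x_def)
  qed
qed

section \<open>Recovering an operad from its algebras\<close>

text \<open>The polynomials that vanish in the free algebra over \<open>Mag / I\<close> on the variables.\<close>

definition free_relations :: "(nat \<Rightarrow> (nat mterm \<Rightarrow>\<^sub>0 'k::field) set) \<Rightarrow> (nat mterm \<Rightarrow>\<^sub>0 'k) set" where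
  "free_relations I = fvs.span {lin_ext (mterm_subst \<sigma>) f | n f \<sigma>. f \<in> I n}"

lemma subst_in_free_relations: "f \<in> I n \<Longrightarrow> lin_ext (mterm_subst \<sigma>) f \<in> free_relations I"
  unfolding free_relations_def by (rule fvs.span_base) blast

lemma subspace_free_relations: "fvs.subspace (free_relations I)"
  unfolding free_relations_def by (rule fvs.subspace_span)

lemma product_in_Mag: "basis (App (Var 0) (Var 1)) \<in> Mag 2"
  by (rule single_in_Mag) auto

text \<open>Multiplying an instance of \<open>f\<close> by \<open>t\<close> is again a substitution
  instance: compose \<open>f\<close> into one input of the generating product, then substitute
  \<open>t\<close> for the other.\<close>

lemma free_relations_mult_monomial:
  assumes I: "operadic_ideal I" and f: "f \<in> free_relations I"
  shows "lin_ext (\<lambda>s. App s t) f \<in> free_relations I" "lin_ext (App t) f \<in> free_relations I"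
proof -
  let ?V = "{f. lin_ext (\<lambda>s. App s t) f \<in> free_relations I \<and> lin_ext (App t) f \<in> free_relations I}"
  have "free_relations I \<subseteq> ?V"
    unfolding free_relations_def[of I]
  proof (rule fvs.span_minimal, fold free_relations_def)
    show "fvs.subspace ?V"
      using subspace_free_relations[of I] by (simp add: fvs.subspace_def lin_ext_add lin_ext_fscale)
    show "{lin_ext (mterm_subst \<sigma>) f | n f \<sigma>. f \<in> I n} \<subseteq> ?V"
    proof safe
      fix n f \<sigma> assume f: "f \<in> I n"
      have k: "set (leaves s) = {..<n}" if "s \<in> Poly_Mapping.keys f" for s
        using that f operadic_ideal_subset[OF I] keys_Mag by blast
      \<comment> \<open>Here \<open>f\<close> keeps its variables \<open>0, ..., n - 1\<close>, and
        the new right factor is variable \<open>n\<close>.\<close>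
      have "lin_ext (\<lambda>s. App s t) (lin_ext (mterm_subst \<sigma>) f)
          = lin_ext (mterm_subst (\<sigma>(n := t))) (mag_comp 0 n (basis (App (Var 0) (Var 1))) f)"
        unfolding mag_comp_def bilin_ext_single_left fvs.scale_one lin_ext_lin_ext
        using k by (intro lin_ext_cong)
          (auto simp: mterm_comp_def map_mterm_conv_subst mterm_subst_subst intro!: mterm_subst_cong)
      then show "lin_ext (\<lambda>s. App s t) (lin_ext (mterm_subst \<sigma>) f) \<in> free_relations I"
        using operadic_ideal_comp_right[OF I _ product_in_Mag f, of 0] subst_in_free_relations by auto
      \<comment> \<open>Here the variables of \<open>f\<close> are shifted up by one, which leaves
        variable \<open>0\<close> for \<open>t\<close>.\<close>
      have "lin_ext (App t) (lin_ext (mterm_subst \<sigma>) f)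
          = lin_ext (mterm_subst (case_nat t \<sigma>)) (mag_comp 1 n (basis (App (Var 0) (Var 1))) f)"
        unfolding mag_comp_def bilin_ext_single_left fvs.scale_one lin_ext_lin_ext
        using k by (intro lin_ext_cong)
          (auto simp: mterm_comp_def map_mterm_conv_subst mterm_subst_subst intro!: mterm_subst_cong)
      then show "lin_ext (App t) (lin_ext (mterm_subst \<sigma>) f) \<in> free_relations I"
        using operadic_ideal_comp_right[OF I _ product_in_Mag f, of 1] subst_in_free_relations by auto
    qed
  qed
  then show "lin_ext (\<lambda>s. App s t) f \<in> free_relations I" "lin_ext (App t) f \<in> free_relations I"
    using f by auto
qed

lemma free_relations_mult:
  assumes "operadic_ideal I" "f \<in> free_relations I"
  shows "bilin_ext App f g \<in> free_relations I" "bilin_ext App g f \<in> free_relations I"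
proof -
  have "bilin_ext App f g \<in> free_relations I \<and> bilin_ext App g f \<in> free_relations I"
  proof (induction g rule: poly_mapping_induct)
    case zero
    show ?case using fvs.subspace_0[OF subspace_free_relations] by simp
  next
    case (add x c g)
    then show ?case
      using free_relations_mult_monomial[OF assms]
      by (auto simp: bilin_ext_add_left bilin_ext_add_right bilin_ext_single_left bilin_ext_single_right
          intro!: fvs.subspace_add[OF subspace_free_relations]
            fvs.subspace_scale[OF subspace_free_relations])
  qed
  then show "bilin_ext App f g \<in> free_relations I" "bilin_ext App g f \<in> free_relations I" by auto
qed

text \<open>A multilinear substitution is a composite of renamings and of substitutions
  \<open>x\<^sub>i := x\<^sub>i x\<^sub>i\<^sub>+\<^sub>1\<close> that shift the later variables; the induction peels off the latter.\<close>

lemma multilinear_subst_in_ideal: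
  assumes I: "operadic_ideal I" and "f \<in> I m"
    and "distinct (concat (map (\<lambda>i. leaves (\<sigma> i)) [0..<m]))"
    and "set (concat (map (\<lambda>i. leaves (\<sigma> i)) [0..<m])) = {..<n}"
  shows "lin_ext (mterm_subst \<sigma>) f \<in> I n"
  using assms(2-)
proof (induction "sum_list (map (\<lambda>i. size (\<sigma> i)) [0..<m])" arbitrary: m f \<sigma> rule: less_induct)
  case less
  have k: "set (leaves s) = {..<m}" if "s \<in> Poly_Mapping.keys f" for s
    using that less.prems(1) operadic_ideal_subset[OF I] keys_Mag by blast
  show ?case
  proof (cases "\<forall>i<m. \<exists>j. \<sigma> i = Var j")
    case True
    then obtain \<pi> where \<pi>: "\<And>i. i < m \<Longrightarrow> \<sigma> i = Var (\<pi> i)" by metis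
    have c: "concat (map (\<lambda>i. leaves (\<sigma> i)) [0..<m]) = map \<pi> [0..<m]"
    proof -
      have "map (\<lambda>i. leaves (\<sigma> i)) [0..<m] = map (\<lambda>i. [\<pi> i]) [0..<m]" using \<pi> by simp
      then show ?thesis by (simp only: concat_map_singleton)
    qed
    have inj: "inj_on \<pi> {..<m}" and im: "\<pi> ` {..<m} = {..<n}"
      using less.prems(2,3) unfolding c by (auto simp: distinct_map lessThan_atLeast0)
    have "m = n" using card_image[OF inj] im by simp
    \<comment> \<open>\<open>\<sigma>\<close> determines the renaming only below \<open>m\<close>; a
      permutation has to fix everything else.\<close>
    define \<pi>' where "\<pi>' i = (if i < m then \<pi> i else i)" for i
    have "bij_betw \<pi>' {..<m} {..<m}"
      using inj im \<open>m = n\<close> by (auto simp: bij_betw_def \<pi>'_def inj_on_def)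
    then have p: "\<pi>' permutes {..<m}"
      by (rule bij_imp_permutes) (auto simp: \<pi>'_def)
    have "lin_ext (mterm_subst \<sigma>) f = lin_ext (map_mterm \<pi>') f"
      using k \<pi> by (intro lin_ext_cong)
        (auto simp: map_mterm_conv_subst \<pi>'_def intro!: mterm_subst_cong)
    then show ?thesis using operadic_ideal_permute[OF I less.prems(1) p] \<open>m = n\<close> by simp
  next
    case False
    then obtain i s t where i: "i < m" and st: "\<sigma> i = App s t" by (metis mterm.exhaust)
    define f' where "f' = mag_comp i 2 f (basis (App (Var 0) (Var 1)))"
    have f': "f' \<in> I (Suc m)"
      using operadic_ideal_comp_left[OF I i less.prems(1) product_in_Mag] by (simp add: f'_def)
    \<comment> \<open>The two new inputs of \<open>f'\<close> receive \<open>s\<close> and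
      \<open>t\<close>, and later entries move up by one. The concatenated list of leaves is
      unchanged, and one \<open>App\<close> disappears from the total size.\<close>
    define \<tau> where "\<tau> j = (if j < i then \<sigma> j else if j = i then s else if j = Suc i then t else \<sigma> (j - 1))" for j
    obtain k where m: "m = i + Suc k" using i less_imp_Suc_add by auto
    have app: "[0..<i + j] = [0..<i] @ [i..<i + j]" for j
      by (rule upt_add_eq_append) simp
    have split: "[0..<m] = [0..<i] @ [i] @ [Suc i..<m]"
      using app[of "Suc k"] i by (simp add: m upt_conv_Cons del: upt_Suc)
    have split': "[0..<Suc m] = [0..<i] @ [i, Suc i] @ map Suc [Suc i..<m]"
      using app[of "Suc (Suc k)"] i by (simp add: m map_Suc_upt upt_conv_Cons del: upt_Suc)
    have \<tau>: "map (\<lambda>j. F (\<tau> j)) [0..<Suc m]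
      = map (\<lambda>j. F (\<sigma> j)) [0..<i] @ [F s, F t] @ map (\<lambda>j. F (\<sigma> j)) [Suc i..<m]"
      for F :: "nat mterm \<Rightarrow> 'x"
      unfolding split' by (auto simp: \<tau>_def)
    have \<sigma>: "map (\<lambda>j. F (\<sigma> j)) [0..<m]
      = map (\<lambda>j. F (\<sigma> j)) [0..<i] @ [F (App s t)] @ map (\<lambda>j. F (\<sigma> j)) [Suc i..<m]"
      for F :: "nat mterm \<Rightarrow> 'x"
      unfolding split by (simp add: st)
    have l: "concat (map (\<lambda>j. leaves (\<tau> j)) [0..<Suc m]) = concat (map (\<lambda>i. leaves (\<sigma> i)) [0..<m])"
      unfolding \<tau> \<sigma> by simp
    have sz: "sum_list (map (\<lambda>i. size (\<tau> i)) [0..<Suc m]) < sum_list (map (\<lambda>i. size (\<sigma> i)) [0..<m])"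
      unfolding \<tau> \<sigma> by simp
    have "lin_ext (mterm_subst \<tau>) f' \<in> I n"
      by (intro less.hyps[OF sz f']) (simp_all only: l less.prems)
    also have "lin_ext (mterm_subst \<tau>) f' = lin_ext (mterm_subst \<sigma>) f"
      unfolding f'_def mag_comp_def bilin_ext_single_right fvs.scale_one lin_ext_lin_ext
      by (intro lin_ext_cong)
        (auto simp: mterm_comp_def mterm_subst_subst \<tau>_def st intro!: mterm_subst_cong)
    finally show ?thesis .
  qed
qed

definition restrict_keys :: "'a set \<Rightarrow> ('a \<Rightarrow>\<^sub>0 'k::zero) \<Rightarrow> ('a \<Rightarrow>\<^sub>0 'k)" where
  "restrict_keys D f = Poly_Mapping.mapp (\<lambda>x c. c when x \<in> D) f"

lemma lookup_restrict_keys [simp]: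
  "Poly_Mapping.lookup (restrict_keys D f) x = (Poly_Mapping.lookup f x when x \<in> D)"
  by (auto simp: restrict_keys_def lookup_mapp when_def in_keys_iff)

lemma restrict_keys_id: "Poly_Mapping.keys f \<subseteq> D \<Longrightarrow> restrict_keys D f = f"
  by (rule poly_mapping_eqI) (auto simp: when_def in_keys_iff)

lemma restrict_keys_disjoint: "Poly_Mapping.keys f \<inter> D = {} \<Longrightarrow> restrict_keys D f = 0"
  by (rule poly_mapping_eqI) (auto simp: when_def in_keys_iff)

text \<open>Substitution instances of multilinear polynomials are homogeneous for the multidegree, so the
  multilinear part of such an instance is the whole instance or zero.\<close>

lemma free_relations_multilinear:
  fixes I :: "nat \<Rightarrow> (nat mterm \<Rightarrow>\<^sub>0 'k::field) set"
  assumes I: "operadic_ideal I" and f: "f \<in> free_relations I" "f \<in> Mag n"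
  shows "f \<in> I n"
proof -
  define D where "D = {t. distinct (leaves t) \<and> set (leaves t) = {..<n}}"
  have sub: "fvs.subspace (I n)" using I by (rule operadic_ideal_subspace)
  \<comment> \<open>Having its multilinear part of arity \<open>n\<close> in \<open>I n\<close> is a
    linear condition, so it is tested on the spanning instances.\<close>
  have "free_relations I \<subseteq> {f. restrict_keys D f \<in> I n}"
    unfolding free_relations_def
  proof (rule fvs.span_minimal)
    have "restrict_keys D (f + g) = restrict_keys D f + restrict_keys D g"
      "restrict_keys D (fscale c f) = fscale c (restrict_keys D f)" "restrict_keys D (0 :: nat mterm \<Rightarrow>\<^sub>0 'k) = 0"
      for f g :: "nat mterm \<Rightarrow>\<^sub>0 'k" and c
      by (rule poly_mapping_eqI, simp add: lookup_add when_def)+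
    then show "fvs.subspace {f. restrict_keys D f \<in> I n}"
      using sub by (simp add: fvs.subspace_def)
    show "{lin_ext (mterm_subst \<sigma>) f | n f \<sigma>. f \<in> I n} \<subseteq> {f. restrict_keys D f \<in> I n}"
    proof safe
      fix m f and \<sigma> :: "nat \<Rightarrow> nat mterm" assume f: "f \<in> I m"
      define L where "L = concat (map (\<lambda>i. leaves (\<sigma> i)) [0..<m])"
      \<comment> \<open>Every monomial of \<open>f\<close> contains each variable once, so all
        monomials of the instance have the same multidegree, namely that of
        \<open>L\<close>.\<close>
      have "mset (leaves (mterm_subst \<sigma> s)) = mset L" if "s \<in> Poly_Mapping.keys f" for s
      proof -
        have "f \<in> Mag m" using f operadic_ideal_subset[OF I] by blast
        then have "mset (leaves s) = mset [0..<m]"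
          using keys_Mag[of f m s] that
          by (subst set_eq_iff_mset_eq_distinct[symmetric]) (simp_all add: lessThan_atLeast0)
        then have "mset (map (\<lambda>i. leaves (\<sigma> i)) (leaves s)) = mset (map (\<lambda>i. leaves (\<sigma> i)) [0..<m])"
          by (simp only: mset_map)
        then show ?thesis
          unfolding leaves_subst L_def mset_concat
          by (simp only: mset_map[symmetric] sum_mset_sum_list[symmetric])
            (simp only: mset_map multiset.map_comp)
      qed
      then have D: "mterm_subst \<sigma> s \<in> D \<longleftrightarrow> distinct L \<and> set L = {..<n}"
        if "s \<in> Poly_Mapping.keys f" for s
        using that unfolding D_def mem_Collect_eq by (metis mset_eq_imp_distinct_iff set_mset_mset)
      show "restrict_keys D (lin_ext (mterm_subst \<sigma>) f) \<in> I n"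
      proof (cases "distinct L \<and> set L = {..<n}")
        case True
        then have "restrict_keys D (lin_ext (mterm_subst \<sigma>) f) = lin_ext (mterm_subst \<sigma>) f"
          using keys_lin_ext[of "mterm_subst \<sigma>" f] D by (intro restrict_keys_id) blast
        then show ?thesis
          using True multilinear_subst_in_ideal[OF I f, of \<sigma> n] by (simp add: L_def)
      next
        case False
        then have "restrict_keys D (lin_ext (mterm_subst \<sigma>) f) = 0"
          using keys_lin_ext[of "mterm_subst \<sigma>" f] D by (intro restrict_keys_disjoint) blast
        then show ?thesis using sub by (simp add: fvs.subspace_0)
      qed
    qed
  qed
  moreover have "restrict_keys D f = f"
    using f(2) by (intro restrict_keys_id) (auto simp: D_def Mag_def)
  ultimately show ?thesis using f(1) by (metis mem_Collect_eq subsetD)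
qed

section \<open>Embedding the free algebra into the field\<close>

instance mterm :: (countable) countable
  by countable_datatype

text \<open>An infinite field is in bijection with its square. Iterating this pairing encodes a
  finite list of monomials with coefficients as one scalar; the countably many monomials are
  numbered by \<open>of_nat\<close>, injective in characteristic 0.\<close>

lemma inj_poly_mapping_into_field:
  "\<exists>E :: (nat mterm \<Rightarrow>\<^sub>0 'k::field_char_0) \<Rightarrow> 'k. inj E"
proof -
  have "\<exists>p. bij_betw p ((UNIV :: 'k set) \<times> (UNIV :: 'k set)) (UNIV :: 'k set)"
    unfolding card_of_ordIso by (rule card_of_Times_same_infinite[OF infinite_UNIV_char_0])
  then obtain p :: "'k \<times> 'k \<Rightarrow> 'k" where "inj p" by (auto simp: bij_betw_def)
  then have p: "p (a, b) = p (c, d) \<longleftrightarrow> a = c \<and> b = d" for a b c d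
    by (simp add: inj_eq)
  define term_code :: "nat mterm \<Rightarrow> 'k" where "term_code t = of_nat (to_nat t)" for t
  define code :: "(nat mterm \<times> 'k) list \<Rightarrow> 'k" where
    "code = (\<lambda>xs. foldr (\<lambda>(t, c) r. p (p (term_code t, c), r)) xs 0)"
  have tc: "term_code s = term_code t \<longleftrightarrow> s = t" for s t by (simp add: term_code_def)
  \<comment> \<open>The final \<open>0\<close> may itself be a value of \<open>p\<close>, so lists
    of different lengths can share a code. The length is therefore recorded separately.\<close>
  have code: "code xs = code ys \<Longrightarrow> length xs = length ys \<Longrightarrow> xs = ys" for xs ys
  proof (induction xs arbitrary: ys)
    case (Cons x xs)
    then obtain y zs where "ys = y # zs" by (cases ys) auto
    then show ?case using Cons by (cases x; cases y) (auto simp: code_def p tc)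
  qed simp
  \<comment> \<open>Any enumeration of the graph of \<open>f\<close> on its support will do, since
    decoding uses only its set of entries.\<close>
  define lst where "lst f = (SOME xs. set xs = (\<lambda>t. (t, Poly_Mapping.lookup f t)) ` Poly_Mapping.keys f)"
    for f :: "nat mterm \<Rightarrow>\<^sub>0 'k"
  have lst: "set (lst f) = (\<lambda>t. (t, Poly_Mapping.lookup f t)) ` Poly_Mapping.keys f" for f
    unfolding lst_def by (rule someI_ex) (simp add: finite_list)
  have "inj (\<lambda>f. p (of_nat (length (lst f)), code (lst f)))"
  proof (rule injI)
    fix f g assume "p (of_nat (length (lst f)), code (lst f)) = p (of_nat (length (lst g)), code (lst g))"
    then have "lst f = lst g" by (intro code) (simp_all add: p)
    then have eq: "(\<lambda>t. (t, Poly_Mapping.lookup f t)) ` Poly_Mapping.keys f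
        = (\<lambda>t. (t, Poly_Mapping.lookup g t)) ` Poly_Mapping.keys g"
      by (metis lst)
    show "f = g"
    proof (rule poly_mapping_eqI)
      fix t
      show "Poly_Mapping.lookup f t = Poly_Mapping.lookup g t"
      proof (cases "t \<in> Poly_Mapping.keys f \<or> t \<in> Poly_Mapping.keys g")
        case True
        then show ?thesis using eq by (auto simp: set_eq_iff image_iff)
      next
        case False
        then show ?thesis by (simp add: in_keys_iff)
      qed
    qed
  qed
  then show ?thesis by blast
qed

text \<open>The free algebra on the variables. It satisfies \<open>I\<close> because its values at
  monomials are substitution instances; a multilinear polynomial that vanishes at its generators
  already lies in \<open>I\<close>.\<close>

lemma exists_free_operad_algebra:
  fixes I :: "nat \<Rightarrow> (nat mterm \<Rightarrow>\<^sub>0 'k::field_char_0) set" and h :: "'k \<Rightarrow> 'v"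
  assumes I: "operadic_ideal I" and h: "inj h"
  obtains U :: "('k, 'v) module"
  where "operad_algebra I U"
    and "\<And>J n. operadic_ideal J \<Longrightarrow> operad_algebra J U \<Longrightarrow> J n \<subseteq> I n"
proof -
  let ?N = "free_relations I"
  note N = subspace_free_relations[of I]
  obtain E :: "(nat mterm \<Rightarrow>\<^sub>0 'k) \<Rightarrow> 'k" where E: "inj E" using inj_poly_mapping_into_field by blast
  \<comment> \<open>The predicate depends only on the coset of \<open>f\<close>, so the choice is a
    canonical representative.\<close>
  define rep where "rep f = (SOME g. f - g \<in> ?N)" for f
  have rep: "f - rep f \<in> ?N" for f
    unfolding rep_def by (rule someI[of _ f]) (simp add: fvs.subspace_0[OF N])
  have rep_eq: "rep f = rep g \<longleftrightarrow> f - g \<in> ?N" for f g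
  proof
    assume "rep f = rep g"
    then show "f - g \<in> ?N" using fvs.subspace_diff[OF N rep[of f] rep[of g]] by simp
  next
    assume *: "f - g \<in> ?N"
    have "f - x \<in> ?N \<longleftrightarrow> g - x \<in> ?N" for x
      using fvs.subspace_diff[OF N _ *, of "f - x"] fvs.subspace_add[OF N _ *, of "g - x"] by auto
    then show "rep f = rep g" by (simp add: rep_def)
  qed
  \<comment> \<open>Coset to representative, representative to scalar, scalar to \<open>'v\<close>:
    the last two maps are injective.\<close>
  define q where "q f = h (E (rep f))" for f
  have q: "q f = q g \<longleftrightarrow> f - g \<in> ?N" for f g
    using h E by (simp add: q_def inj_eq rep_eq)
  define U where "U = quotient_algebra q App"
  interpret image_algebra U q UNIV App
    unfolding U_def
    by (rule image_algebra_quotient[OF N q]) (simp_all add: free_relations_mult[OF I])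
  have "magma_eval App x t = mterm_subst x t" for x :: "nat \<Rightarrow> nat mterm" and t
    by (induction t) auto
  then have sub: "magma_eval App x = mterm_subst x" for x :: "nat \<Rightarrow> nat mterm"
    by (rule ext)
  have ev: "eval_poly U (\<lambda>i. q (basis (x i))) f = q (lin_ext (mterm_subst x) f)"
    for x :: "nat \<Rightarrow> nat mterm" and f
    using eval_poly_q_basis[of x f] by (simp add: sub)
  show ?thesis
  proof (rule that)
    show "operad_algebra I U"
      unfolding operad_algebra_def
    proof (intro conjI allI ballI impI nonassoc)
      fix n f and \<rho> :: "nat \<Rightarrow> 'v" assume f: "f \<in> I n" and \<rho>: "\<forall>i. \<rho> i \<in> carrier U"
      show "eval_poly U \<rho> f = \<zero>\<^bsub>U\<^esub>"
      proof (rule eval_poly_zeroI)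
        show "f \<in> Mag n" using f operadic_ideal_subset[OF I] by blast
        show "eval_poly U (\<lambda>i. q (basis (x i))) f = \<zero>\<^bsub>U\<^esub>" for x
          unfolding ev q_zero q using subst_in_free_relations[of f I n x] f by simp
      qed (use \<rho> in auto)
    qed
    fix J n assume J: "operadic_ideal J" "operad_algebra J U"
    show "J n \<subseteq> I n"
    proof
      fix f assume f: "f \<in> J n"
      have "\<forall>\<rho>. (\<forall>i. \<rho> i \<in> carrier U) \<longrightarrow> eval_poly U \<rho> f = \<zero>\<^bsub>U\<^esub>"
        using J(2) f by (simp add: operad_algebra_def)
      \<comment> \<open>The generic point: variable \<open>i\<close> is sent to the class of
        \<open>Var i\<close>, where \<open>f\<close> evaluates to its own class.\<close>
      then have "eval_poly U (\<lambda>i. q (basis (Var i))) f = \<zero>\<^bsub>U\<^esub>"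
        by (elim allE impE) (simp_all add: q_basis_closed)
      moreover have "lin_ext (mterm_subst Var) f = f"
        by (induction f rule: poly_mapping_induct) (simp_all add: lin_ext_add)
      ultimately have "f \<in> ?N" by (simp add: ev q_zero q)
      then show "f \<in> I n"
        using free_relations_multilinear[OF I] operadic_ideal_subset[OF J(1)] f by blast
    qed
  qed
qed

lemma operadic_ideal_LieAdm: "operadic_ideal LieAdm"
  unfolding LieAdm_def by (rule operadic_ideal_quadratic_operad) (simp add: commutator_jacobi_in_Mag)

theorem proposition5p1:
  fixes Q :: "nat \<Rightarrow> (nat mterm \<Rightarrow>\<^sub>0 'k::field_char_0) set"
  assumes "\<exists>h :: 'k \<Rightarrow> 'v. inj h"
  shows "is_koszul_dual TYPE('v) diCom_I Q \<longleftrightarrow> Q = LieAdm"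
proof -
  obtain h :: "'k \<Rightarrow> 'v" where h: "inj h" using assms by blast
  have dual: "operad_algebra LieAdm U \<longleftrightarrow>
      (\<forall>S :: ('k, 'v) module. operad_algebra diCom_I S \<longrightarrow> lie_admissible (tensor_algebra S U))"
    if U: "nonassoc_algebra U" for U :: "('k, 'v) module"
    unfolding operad_algebra_LieAdm_iff[OF U]
    using lie_admissible_tensor lie_admissible_of_tensor_ground_field[OF h U]
      operad_algebra_ground_field[OF h] by blast
  show ?thesis
  proof
    assume "Q = LieAdm"
    then show "is_koszul_dual TYPE('v) diCom_I Q"
      unfolding is_koszul_dual_def using dual operadic_ideal_LieAdm by blast
  next
    assume "is_koszul_dual TYPE('v) diCom_I Q"
    then have Q: "operadic_ideal Q"
      and "\<And>U :: ('k, 'v) module. nonassoc_algebra U \<Longrightarrow>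
        operad_algebra Q U \<longleftrightarrow> operad_algebra LieAdm U"
      using dual unfolding is_koszul_dual_def by blast+
    \<comment> \<open>\<open>operad_algebra\<close> includes \<open>nonassoc_algebra\<close>, so the
      equivalence extends to every record \<open>U\<close>.\<close>
    then have eq: "operad_algebra Q U \<longleftrightarrow> operad_algebra LieAdm U" for U :: "('k, 'v) module"
      unfolding operad_algebra_def by blast
    \<comment> \<open>The free algebra over \<open>Mag / LieAdm\<close> is by \<open>eq\<close> also
      an algebra over \<open>Mag / Q\<close>; the reverse inclusion exchanges the roles.\<close>
    have "Q n \<subseteq> LieAdm n" for n
      using exists_free_operad_algebra[OF operadic_ideal_LieAdm h] Q eq by metis
    moreover have "LieAdm n \<subseteq> Q n" for n
      using exists_free_operad_algebra[OF Q h] operadic_ideal_LieAdm eq by metis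
    ultimately show "Q = LieAdm" by blast
  qed
qed

end
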